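(* Let $h$ be a boundary function and suppose that (Poly-$R_1$) and $\mathbf{HK}^h_B$ hold. Then for every $T>0$, $$q(t,x,y)\simeq e^{-t\phi(\lambda_D)}\,h(1,x,y),\qquad (t,x,y)\in[T,\infty)\times D\times D,$$ where $\lambda_D>0$ is the constant in condition $\mathbf{HK}^h_B$.
   Context: Notation: $a\wedge b=\min$, $a\vee b=\max$; $f\simeq g$ means $c_1g\le f\le c_2g$ on the specified range for some constants $c_1,c_2>0$. Quotients $c/0$ with $c>0$ are $+\infty$. Subordinator: $S=(S_t)_{t\ge0}$ is a driftless subordinator (non-decreasing pure-jump Lévy process, $S_0=0$) with Laplace exponent $\phi(\lambda)=-\log\mathbb{E}e^{-\lambda S_1}=\int_0^\infty(1-e^{-\lambda s})\nu(ds)$ and $w(r):=\nu(r,\infty)$. Condition (Poly-$R_1$), $R_1\in(0,\infty]$: there are constants $c_1,c_2>0$, $\beta_2\ge\beta_1>0$ with $c_1(R/r)^{\beta_1}\le w(r)/w(R)\le c_2(R/r)^{\beta_2}$ for all $0<r\le R<R_1$. Space and process: $(E,\rho)$ is a locally compact separable metric space in which all bounded closed sets are compact, $m$ is a positive Radon measure on $E$ with full support, $B(x,r)$ is the open ball, $V(x,r)=m(B(x,r))$. There are $R_E\in(0,\infty]$ and $d_2\ge d_1>0$ such that for every $a\ge1$ there is $C_V\ge1$ with $C_V^{-1}(R/r)^{d_1}\le V(x,R)/V(x,r)\le C_V(R/r)^{d_2}$ for all $x\in E$, $0<r\le R<aR_E$. $D\subset E$ is a proper open subset. $Y^D$ is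 a Hunt process in $D$ independent of $S$ whose semigroup has a density (heat kernel) $p_D(t,x,y)$ with respect to $m$; $X_t=Y^D_{S_t}$ has heat kernel $q(t,x,y)=\int_0^\infty p_D(s,x,y)\mathbb{P}(S_t\in ds)$. Scale functions: $\Phi,\Psi:[0,\infty)\to[0,\infty)$ are strictly increasing, $\Psi\ge\Phi$, and for some constants $\alpha_1,\dots,\alpha_4,c_1,\dots,c_4>0$ and all $R\ge r>0$: $c_1(R/r)^{\alpha_1}\le\Phi(R)/\Phi(r)\le c_2(R/r)^{\alpha_2}$ and $c_3(R/r)^{\alpha_3}\le\Psi(R)/\Psi(r)\le c_4(R/r)^{\alpha_4}$. Boundary function: $h:(0,\infty)\times D\times D\to[0,1]$ such that (H1) $s\mapsto h(s,x,y)$ is non-increasing for all $x,y\in D$; (H2) there are $c_1>0$, $\gamma\ge0$ with $s^\gamma h(s,x,y)\le c_1t^\gamma h(t,x,y)$ for $0<s\le t<4\Phi(\mathrm{diam}(D))+1$, $x,y\in D$. Heat kernel condition: for $C_0\in\{0,1\}$ and $c>0$ put $$I_{c}(t,x,y)=\frac1{V(x,\Phi^{-1}(t))}\wedge\Big(\frac{C_0t}{V(x,\rho(x,y))\Psi(\rho(x,y))}+\frac1{V(x,\Phi^{-1}(t))}\exp\Big(-\frac{c\,\rho(x,y)^2}{\Phi^{-1}(t)^2}\Big)\Big)$$ (the first summand is absent if $C_0=0$). $\mathbf{HK}^h_B$: $D$ is bounded; (i) there are $C_0\in\{0,1\}$ and $c_1,c_2,c_3,c_4>0$ with $c_1h(t,x,y)I_{c_2}(t,x,y)\le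 p_D(t,x,y)\le c_3h(t,x,y)I_{c_4}(t,x,y)$ for all $(t,x,y)\in(0,1]\times D\times D$; (ii) there is $\lambda_D>0$ with $p_D(t,x,y)\simeq e^{-\lambda_Dt}h(1,x,y)$ for $(t,x,y)\in[1,\infty)\times D\times D$. Standing convention: $\Phi$ is normalized (by multiplication by a constant) so that $\Phi(\mathrm{diam}(D))<R_1/8$. *)

theory Defs
  imports "HOL-Probability.Probability"
begin

section \<open>Subordinators\<close>

definition levy_exponent :: "real measure \<Rightarrow> real \<Rightarrow> real" where
  "levy_exponent \<nu> u = (\<integral>s. (1 - exp (- u * s)) \<partial>\<nu>)"

definition levy_tail :: "real measure \<Rightarrow> real \<Rightarrow> real" where
  "levy_tail \<nu> r = measure \<nu> {r<..}"

text \<open>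
  Being driftless and pure-jump is expressed by the absence of a linear term \<open>b * u\<close> in the
  representation of the Laplace exponent.  Left limits of the paths exist by monotonicity.
\<close>
locale driftless_subordinator = prob_space M for M :: "'w measure" +
  fixes S :: "real \<Rightarrow> 'w \<Rightarrow> real" and \<nu> :: "real measure"
  assumes rv_S: "t \<ge> 0 \<Longrightarrow> random_variable borel (S t)"
    and start_S: "AE \<omega> in M. S 0 \<omega> = 0"
    and mono_S: "AE \<omega> in M. mono_on {0..} (\<lambda>t. S t \<omega>)"
    and right_continuous_S: "AE \<omega> in M. \<forall>t\<ge>0. continuous (at_right t) (\<lambda>t. S t \<omega>)"
    and independent_increments:
      "(\<And>i. 0 \<le> \<tau> i) \<Longrightarrow> mono \<tau> \<Longrightarrow>
        indep_vars (\<lambda>_. borel) (\<lambda>i \<omega>. S (\<tau> (Suc i)) \<omega> - S (\<tau> i) \<omega>) {..<n :: nat}"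
    and stationary_increments:
      "0 \<le> s \<Longrightarrow> 0 \<le> t \<Longrightarrow> distr M borel (\<lambda>\<omega>. S (s + t) \<omega> - S s \<omega>) = distr M borel (S t)"
    and sets_nu: "sets \<nu> = sets borel"
    and nu_nonpos: "emeasure \<nu> {..0} = 0"
    and nu_levy: "(\<integral>\<^sup>+ s. ennreal (min 1 s) \<partial>\<nu>) < \<infinity>"
    and laplace_exponent:
      "0 \<le> u \<Longrightarrow> - ln (expectation (\<lambda>\<omega>. exp (- u * S 1 \<omega>))) = levy_exponent \<nu> u"

text \<open>
  With the HOL convention \<open>x / 0 = 0\<close> the lower bound fails as soon as \<open>levy_tail \<nu> R = 0\<close>; with
  the convention \<open>c / 0 = \<infinity>\<close> it is the upper bound that fails.
\<close>
definition poly_cond :: "real measure \<Rightarrow> ereal \<Rightarrow> bool" where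
  "poly_cond \<nu> R1 \<longleftrightarrow> 0 < R1 \<and>
    (\<exists>c1>0. \<exists>c2>0. \<exists>\<beta>1>0. \<exists>\<beta>2\<ge>\<beta>1. \<forall>r R. 0 < r \<and> r \<le> R \<and> ereal R < R1 \<longrightarrow>
      c1 * (R / r) powr \<beta>1 \<le> levy_tail \<nu> r / levy_tail \<nu> R \<and>
      levy_tail \<nu> r / levy_tail \<nu> R \<le> c2 * (R / r) powr \<beta>2)"

section \<open>The metric measure space\<close>

definition radon_measure :: "'a::topological_space measure \<Rightarrow> bool" where
  "radon_measure m \<longleftrightarrow> sets m = sets borel \<and>
    (\<forall>K. compact K \<longrightarrow> emeasure m K < \<infinity>) \<and>
    (\<forall>A\<in>sets borel. emeasure m A = (INF U\<in>{U. open U \<and> A \<subseteq> U}. emeasure m U)) \<and>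
    (\<forall>U. open U \<longrightarrow> emeasure m U = (SUP K\<in>{K. compact K \<and> K \<subseteq> U}. emeasure m K))"

definition full_support :: "'a::topological_space measure \<Rightarrow> bool" where
  "full_support m \<longleftrightarrow> (\<forall>U. open U \<and> U \<noteq> {} \<longrightarrow> 0 < emeasure m U)"

definition vol :: "'a::metric_space measure \<Rightarrow> 'a \<Rightarrow> real \<Rightarrow> real" where
  "vol m x r = measure m (ball x r)"

definition volume_scaling :: "'a::metric_space measure \<Rightarrow> bool" where
  "volume_scaling m \<longleftrightarrow>
    (\<exists>RE::ereal. 0 < RE \<and> (\<exists>d1>0. \<exists>d2\<ge>d1. \<forall>a\<ge>1. \<exists>CV\<ge>1. \<forall>x r R.
      0 < r \<and> r \<le> R \<and> ereal R < ereal a * RE \<longrightarrow>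
        (R / r) powr d1 / CV \<le> vol m x R / vol m x r \<and>
        vol m x R / vol m x r \<le> CV * (R / r) powr d2))"

locale volume_space =
  fixes m :: "'a::metric_space measure"
  assumes locally_compact: "locally compact (UNIV :: 'a set)"
    and separable: "separable_space (euclidean :: 'a topology)"
    and bounded_closed_compact: "bounded K \<Longrightarrow> closed K \<Longrightarrow> compact (K :: 'a set)"
    and radon: "radon_measure m"
    and support: "full_support m"
    and scaling: "volume_scaling m"

section \<open>Hunt processes\<close>

text \<open>
  The state space is the one-point compactification of \<open>D\<close>; the cemetery is \<open>None\<close>, which is an
  isolated point if \<open>D\<close> is compact.
\<close>
abbreviation cemetery_top :: "'a::metric_space set \<Rightarrow> 'a option topology" where
  "cemetery_top D \<equiv> Alexandroff_compactification (top_of_set D)"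

definition cemetery_borel :: "'a::metric_space set \<Rightarrow> 'a option measure" where
  "cemetery_borel D = sigma (topspace (cemetery_top D)) {U. openin (cemetery_top D) U}"

text \<open>The process at time \<open>\<sigma> + s\<close>, for \<open>\<sigma>\<close> with values in \<open>[0,\<infinity>]\<close>; it is dead at time \<open>\<infinity>\<close>.\<close>
definition at_random_time ::
    "(real \<Rightarrow> 'w \<Rightarrow> 'a option) \<Rightarrow> ('w \<Rightarrow> ennreal) \<Rightarrow> real \<Rightarrow> 'w \<Rightarrow> 'a option" where
  "at_random_time Y \<sigma> s \<omega> = (if \<sigma> \<omega> = \<infinity> then None else Y (enn2real (\<sigma> \<omega>) + s) \<omega>)"

text \<open>
  Strong Markov property and quasi-left-continuity relative to a filtration indexed by \<open>[0,\<infinity>]\<close>.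
  The simple Markov property is the case of constant stopping times.  Starting from every point is
  the same as starting from every initial law \<open>\<mu>\<close>, as \<open>P\<^sub>\<mu> = \<integral>P\<^sub>x \<mu>(dx)\<close>.
\<close>
definition strong_markov ::
    "'a::metric_space set \<Rightarrow> ('a option \<Rightarrow> 'w measure) \<Rightarrow> (real \<Rightarrow> 'w \<Rightarrow> 'a option) \<Rightarrow>
     'w measure \<Rightarrow> (ennreal \<Rightarrow> 'w measure) \<Rightarrow> bool" where
  "strong_markov D P Y M F \<longleftrightarrow>
    (\<forall>\<sigma>. stopping_time F \<sigma> \<longrightarrow>
      (\<forall>x\<in>topspace (cemetery_top D). \<forall>s\<ge>0. \<forall>A\<in>sets (cemetery_borel D).
        AE \<omega> in P x.
          real_cond_exp (P x) (filtration.pre_sigma (space M) F \<sigma>)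
              (indicator {\<omega>\<in>space M. at_random_time Y \<sigma> s \<omega> \<in> A}) \<omega>
            = measure (P (at_random_time Y \<sigma> 0 \<omega>)) {\<omega>'\<in>space M. Y s \<omega>' \<in> A}))"

definition quasi_left_continuous ::
    "'a::metric_space set \<Rightarrow> ('a option \<Rightarrow> 'w measure) \<Rightarrow> (real \<Rightarrow> 'w \<Rightarrow> 'a option) \<Rightarrow>
     'w measure \<Rightarrow> (ennreal \<Rightarrow> 'w measure) \<Rightarrow> bool" where
  "quasi_left_continuous D P Y M F \<longleftrightarrow>
    (\<forall>\<sigma>s :: nat \<Rightarrow> 'w \<Rightarrow> ennreal.
      (\<forall>n. stopping_time F (\<sigma>s n)) \<and> (\<forall>\<omega>\<in>space M. incseq (\<lambda>n. \<sigma>s n \<omega>)) \<longrightarrow>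
      (\<forall>x\<in>topspace (cemetery_top D). AE \<omega> in P x. (SUP n. \<sigma>s n \<omega>) < \<infinity> \<longrightarrow>
        limitin (cemetery_top D) (\<lambda>n. at_random_time Y (\<sigma>s n) 0 \<omega>)
          (at_random_time Y (\<lambda>\<omega>. SUP n. \<sigma>s n \<omega>) 0 \<omega>) sequentially))"

text \<open>
  Hunt processes in the sense of Fukushima, Oshima and Takeda.  Of \<open>M\<close> only the sample space and
  its \<open>\<sigma>\<close>-algebra matter; \<open>P x\<close> is the law under which the process starts from \<open>x\<close>.
\<close>
locale hunt_process =
  fixes D :: "'a::metric_space set" and M :: "'w measure"
    and P :: "'a option \<Rightarrow> 'w measure" and Y :: "real \<Rightarrow> 'w \<Rightarrow> 'a option"
  assumes prob_P: "x \<in> topspace (cemetery_top D) \<Longrightarrow> prob_space (P x)"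
    and sets_P: "x \<in> topspace (cemetery_top D) \<Longrightarrow> sets (P x) = sets M"
    and measurable_Y: "t \<ge> 0 \<Longrightarrow> Y t \<in> measurable M (cemetery_borel D)"
    and kernel: "t \<ge> 0 \<Longrightarrow> A \<in> sets (cemetery_borel D) \<Longrightarrow>
      (\<lambda>x. measure (P x) {\<omega>\<in>space M. Y t \<omega> \<in> A}) \<in> borel_measurable (cemetery_borel D)"
    and normal: "x \<in> topspace (cemetery_top D) \<Longrightarrow> AE \<omega> in P x. Y 0 \<omega> = x"
    and absorbing: "\<omega> \<in> space M \<Longrightarrow> 0 \<le> s \<Longrightarrow> s \<le> t \<Longrightarrow> Y s \<omega> = None \<Longrightarrow> Y t \<omega> = None"
    and shifts: "\<exists>\<theta>. \<forall>t\<ge>0. \<forall>\<omega>\<in>space M. \<theta> t \<omega> \<in> space M \<and> (\<forall>s\<ge>0. Y s (\<theta> t \<omega>) = Y (s + t) \<omega>)"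
    and right_continuous: "\<omega> \<in> space M \<Longrightarrow> 0 \<le> t \<Longrightarrow>
      limitin (cemetery_top D) (\<lambda>s. Y s \<omega>) (Y t \<omega>) (at_right t)"
    and left_limits: "\<omega> \<in> space M \<Longrightarrow> 0 < t \<Longrightarrow>
      \<exists>l. limitin (cemetery_top D) (\<lambda>s. Y s \<omega>) l (at_left t)"
    and strong_markov_quasi_left_continuous:
      "\<exists>F :: ennreal \<Rightarrow> 'w measure. filtration (space M) F \<and> (\<forall>t. sets (F t) \<subseteq> sets M) \<and>
        (\<forall>t\<ge>0. Y t \<in> measurable (F (ennreal t)) (cemetery_borel D)) \<and>
        (\<forall>t<\<infinity>. sets (F t) = (\<Inter>s\<in>{t<..}. sets (F s))) \<and>
        strong_markov D P Y M F \<and> quasi_left_continuous D P Y M F"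

definition heat_kernel ::
    "'a::metric_space measure \<Rightarrow> 'a set \<Rightarrow> 'w measure \<Rightarrow> ('a option \<Rightarrow> 'w measure) \<Rightarrow>
     (real \<Rightarrow> 'w \<Rightarrow> 'a option) \<Rightarrow> (real \<Rightarrow> 'a \<Rightarrow> 'a \<Rightarrow> real) \<Rightarrow> bool" where
  "heat_kernel m D M P Y p \<longleftrightarrow>
    (\<forall>t>0. \<forall>x\<in>D. \<forall>y\<in>D. 0 \<le> p t x y) \<and>
    (\<forall>x\<in>D. (\<lambda>(t, y). p t x y) \<in>
      borel_measurable (restrict_space borel {0<..} \<Otimes>\<^sub>M restrict_space borel D)) \<and>
    (\<forall>t>0. \<forall>x\<in>D. \<forall>A\<in>sets borel. A \<subseteq> D \<longrightarrow>
      emeasure (P (Some x)) {\<omega>\<in>space M. Y t \<omega> \<in> Some ` A} = (\<integral>\<^sup>+ y\<in>A. ennreal (p t x y) \<partial>m))"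

text \<open>
  Independence of the \<open>\<sigma>\<close>-algebras generated by the paths, under every \<open>P x\<close>; \<open>indep_var\<close> would
  require \<open>Y\<close> and \<open>S\<close> to take values in the same type.
\<close>
definition independent_processes ::
    "'a::metric_space set \<Rightarrow> ('a option \<Rightarrow> 'w measure) \<Rightarrow> (real \<Rightarrow> 'w \<Rightarrow> 'a option) \<Rightarrow>
     (real \<Rightarrow> 'w \<Rightarrow> real) \<Rightarrow> bool" where
  "independent_processes D P Y S \<longleftrightarrow>
    (\<forall>x\<in>topspace (cemetery_top D).
      prob_space.indep_set (P x)
        (sets (vimage_algebra (space (P x)) (\<lambda>\<omega>. \<lambda>t\<in>{0..}. Y t \<omega>) (\<Pi>\<^sub>M t\<in>{0..}. cemetery_borel D)))
        (sets (vimage_algebra (space (P x)) (\<lambda>\<omega>. \<lambda>t\<in>{0..}. S t \<omega>) (\<Pi>\<^sub>M t\<in>{0..}. borel))))"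

text \<open>
  The heat kernel of \<open>X t \<omega> = Y (S t \<omega>) \<omega>\<close>.  The law of \<open>S t\<close> is taken under \<open>P (Some x)\<close>, the law
  of the process started from \<open>x\<close>; when \<open>S\<close> is a \<open>driftless_subordinator\<close> with the same \<open>\<nu>\<close> under
  every \<open>P x\<close>, it does not depend on \<open>x\<close>.
\<close>
definition subordinate_kernel ::
    "('a option \<Rightarrow> 'w measure) \<Rightarrow> (real \<Rightarrow> 'w \<Rightarrow> real) \<Rightarrow> (real \<Rightarrow> 'a \<Rightarrow> 'a \<Rightarrow> real) \<Rightarrow>
     real \<Rightarrow> 'a \<Rightarrow> 'a \<Rightarrow> ennreal" where
  "subordinate_kernel P S p t x y =
    (\<integral>\<^sup>+ s\<in>{0<..}. ennreal (p s x y) \<partial>distr (P (Some x)) borel (S t))"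

section \<open>Scale functions, boundary functions and heat kernel bounds\<close>

definition power_scaling :: "(real \<Rightarrow> real) \<Rightarrow> bool" where
  "power_scaling f \<longleftrightarrow>
    (\<exists>c1>0. \<exists>c2>0. \<exists>\<alpha>1>0. \<exists>\<alpha>2>0. \<forall>r R. 0 < r \<and> r \<le> R \<longrightarrow>
      c1 * (R / r) powr \<alpha>1 \<le> f R / f r \<and> f R / f r \<le> c2 * (R / r) powr \<alpha>2)"

definition scale_functions :: "(real \<Rightarrow> real) \<Rightarrow> (real \<Rightarrow> real) \<Rightarrow> bool" where
  "scale_functions \<Phi> \<Psi> \<longleftrightarrow>
    strict_mono_on {0..} \<Phi> \<and> strict_mono_on {0..} \<Psi> \<and>
    (\<forall>r\<ge>0. 0 \<le> \<Phi> r \<and> \<Phi> r \<le> \<Psi> r) \<and>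
    power_scaling \<Phi> \<and> power_scaling \<Psi>"

text \<open>
  A scale function may have jumps; this inverse agrees with the ordinary one on the range of \<open>f\<close> and
  is constant across each jump (for strictly increasing \<open>f\<close>, using \<open>t < f r\<close> gives the same value).
\<close>
definition scale_inverse :: "(real \<Rightarrow> real) \<Rightarrow> real \<Rightarrow> real" where
  "scale_inverse f t = Inf {r. 0 \<le> r \<and> t \<le> f r}"

text \<open>
  For unbounded \<open>D\<close> the diameter is infinite and the last condition ranges over all times, whereas the library's
  \<open>diameter\<close> is only meaningful for bounded sets.
\<close>
definition boundary_function ::
    "(real \<Rightarrow> real) \<Rightarrow> 'a::metric_space set \<Rightarrow> (real \<Rightarrow> 'a \<Rightarrow> 'a \<Rightarrow> real) \<Rightarrow> bool" where
  "boundary_function \<Phi> D h \<longleftrightarrow>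
    (\<forall>s>0. \<forall>x\<in>D. \<forall>y\<in>D. 0 \<le> h s x y \<and> h s x y \<le> 1) \<and>
    (\<forall>x\<in>D. \<forall>y\<in>D. antimono_on {0<..} (\<lambda>s. h s x y)) \<and>
    (\<exists>c1>0. \<exists>\<gamma>\<ge>0. \<forall>s t. \<forall>x\<in>D. \<forall>y\<in>D.
      0 < s \<and> s \<le> t \<and> (bounded D \<longrightarrow> t < 4 * \<Phi> (diameter D) + 1) \<longrightarrow>
        s powr \<gamma> * h s x y \<le> c1 * t powr \<gamma> * h t x y)"

text \<open>
  On the diagonal the denominator of the jump term vanishes.  In \<^typ>\<open>ennreal\<close> that term is then
  \<open>\<infinity>\<close> for \<open>C0 = 1\<close>, so that the minimum is \<open>1 / V(x, \<Phi>\<^sup>-\<^sup>1(t))\<close>; for \<open>C0 = 0\<close> it is \<open>0 / 0 = 0\<close>.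
\<close>
definition heat_bound ::
    "'a::metric_space measure \<Rightarrow> (real \<Rightarrow> real) \<Rightarrow> (real \<Rightarrow> real) \<Rightarrow> real \<Rightarrow> real \<Rightarrow>
     real \<Rightarrow> 'a \<Rightarrow> 'a \<Rightarrow> ennreal" where
  "heat_bound m \<Phi> \<Psi> C0 c t x y =
    min (1 / ennreal (vol m x (scale_inverse \<Phi> t)))
      (ennreal (C0 * t) / ennreal (vol m x (dist x y) * \<Psi> (dist x y)) +
       1 / ennreal (vol m x (scale_inverse \<Phi> t)) *
         ennreal (exp (- (c * (dist x y)\<^sup>2 / (scale_inverse \<Phi> t)\<^sup>2))))"

definition HK_B ::
    "'a::metric_space measure \<Rightarrow> 'a set \<Rightarrow> (real \<Rightarrow> real) \<Rightarrow> (real \<Rightarrow> real) \<Rightarrow>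
     (real \<Rightarrow> 'a \<Rightarrow> 'a \<Rightarrow> real) \<Rightarrow> (real \<Rightarrow> 'a \<Rightarrow> 'a \<Rightarrow> real) \<Rightarrow> real \<Rightarrow> bool" where
  "HK_B m D \<Phi> \<Psi> h p lamD \<longleftrightarrow>
    bounded D \<and>
    (\<exists>C0\<in>{0, 1}. \<exists>c1>0. \<exists>c2>0. \<exists>c3>0. \<exists>c4>0. \<forall>t\<in>{0<..1}. \<forall>x\<in>D. \<forall>y\<in>D.
      ennreal (c1 * h t x y) * heat_bound m \<Phi> \<Psi> C0 c2 t x y \<le> ennreal (p t x y) \<and>
      ennreal (p t x y) \<le> ennreal (c3 * h t x y) * heat_bound m \<Phi> \<Psi> C0 c4 t x y) \<and>
    0 < lamD \<and>
    (\<exists>c1>0. \<exists>c2>0. \<forall>t\<ge>1. \<forall>x\<in>D. \<forall>y\<in>D.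
      c1 * (exp (- lamD * t) * h 1 x y) \<le> p t x y \<and>
      p t x y \<le> c2 * (exp (- lamD * t) * h 1 x y))"

end

theory Submission
  imports Defs "HOL-Real_Asymp.Real_Asymp"
begin

text \<open>
  Write \<open>\<phi>\<close> for the Laplace exponent, \<open>\<lambda>\<close> for \<open>lamD\<close> and \<open>q(t,x,y)\<close> for the integral of
  \<open>p(s,x,y)\<close> against the law of \<open>S\<^sub>t\<close>.  For \<open>s \<ge> 1\<close> the kernel \<open>p(s,x,y)\<close> is comparable to
  \<open>exp(- \<lambda> s) h(1,x,y)\<close>, and the integral of \<open>exp(- \<lambda> s)\<close> against the law of \<open>S\<^sub>t\<close> is exactly \<open>exp(- t \<phi>(\<lambda>))\<close>.
  So the theorem says that the small values of \<open>S\<^sub>t\<close> do no harm.  Two facts about the kernel at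
  small times and two moment estimates for \<open>S\<^sub>t\<close> show this.

  \<^item> Upper bound.  On \<open>(0,1]\<close> the on-diagonal term of the heat kernel bound, volume scaling and the
    growth of \<open>h\<close> in time give \<open>p(s,x,y) \<le> C s\<^sup>-\<^sup>K h(1,x,y)\<close> for some power \<open>K\<close>
    (\<open>heat_kernel_le_powr\<close>).  It remains to bound the moment \<open>E[S\<^sub>t\<^sup>-\<^sup>K exp(- \<lambda> S\<^sub>t)]\<close> by a multiple of
    \<open>exp(- t \<phi>(\<lambda>))\<close>.  The negative power is dominated by the series of the functions
    \<open>(n + 1)\<^sup>K exp(- n s)\<close>, so that the moment is dominated by a series of values of the Laplace
    transform, with terms \<open>(n + 1)\<^sup>K exp(- t \<phi>(n + \<lambda>))\<close>.  For \<open>t \<ge> T\<close> the excess of \<open>t \<phi>(n + \<lambda>)\<close> over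
    \<open>t \<phi>(\<lambda>)\<close> is at least \<open>T\<close> times \<open>\<phi>(n + \<lambda>) - \<phi>(\<lambda>)\<close>, which grows like a power of \<open>n\<close> by the
    polynomial lower bound on the Levy tail (\<open>negative_moment_le_exp\<close>).

  \<^item> Lower bound.  For \<open>t \<ge> T\<close> a fixed proportion of \<open>E[exp(- \<lambda> S\<^sub>t)]\<close> comes from the event \<open>S\<^sub>t \<ge> \<delta>\<close>, if
    \<open>\<delta>\<close> is small: exponential tilting by one more unit bounds the contribution of \<open>S\<^sub>t < \<delta>\<close> by
    \<open>exp(\<delta>) exp(- t \<phi>(\<lambda> + 1))\<close>, and \<open>\<phi>\<close> is strictly increasing (\<open>exp_moment_away_from_zero_ge\<close>).  On
    \<open>[\<delta>,1]\<close> the Gaussian factor is bounded below because \<open>D\<close> is bounded, so that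
    \<open>p(s,x,y) \<ge> C h(1,x,y)\<close> there (\<open>heat_kernel_ge_const\<close>).

  Both moment estimates follow from the Laplace transform of \<open>S\<^sub>t\<close> alone, which is
  \<open>u \<mapsto> exp(- t \<phi>(u))\<close> for every starting point (\<open>laplace_transform\<close>); this makes the constants
  independent of the starting point.
\<close>

section \<open>The Laplace transform of a subordinator\<close>

text \<open>
  Monotonicity squeezes \<open>n g(t) = g(n t)\<close> between the values of \<open>g\<close> at the integers next to \<open>n t\<close>,
  so \<open>n\<close> times the error \<open>g(t) - t g(1)\<close> is bounded by \<open>g(1)\<close> for all \<open>n\<close>.
\<close>
lemma additive_mono_on_nonneg_imp_linear:
  fixes g :: "real \<Rightarrow> real"
  assumes add: "\<And>s t. 0 \<le> s \<Longrightarrow> 0 \<le> t \<Longrightarrow> g (s + t) = g s + g t"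
    and mono: "\<And>s t. 0 \<le> s \<Longrightarrow> s \<le> t \<Longrightarrow> g s \<le> g t"
    and t: "0 \<le> t"
  shows "g t = t * g 1"
proof -
  have g0: "g 0 = 0" using add[of 0 0] by simp
  have mult: "g (real n * s) = real n * g s" if "0 \<le> s" for n s
    using that by (induction n) (simp_all add: g0 add algebra_simps)
  have "real n * \<bar>g t - t * g 1\<bar> \<le> g 1" for n
  proof -
    define k where "k = nat \<lfloor>real n * t\<rfloor>"
    have k: "real k \<le> real n * t" "real n * t \<le> real (Suc k)"
      unfolding k_def using t by (auto intro!: of_nat_floor) linarith
    have "real k * g 1 \<le> real n * g t" "real n * g t \<le> real (Suc k) * g 1"
      using mono[of "real k * 1" "real n * t"] mono[of "real n * t" "real (Suc k) * 1"] k t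
        mult[OF t, of n] mult[of 1 k] mult[of 1 "Suc k"]
      by (simp_all del: of_nat_Suc)
    moreover have "0 \<le> g 1" using mono[of 0 1] g0 by simp
    then have "real k * g 1 \<le> real n * t * g 1" "real n * t * g 1 \<le> real (Suc k) * g 1"
      using k by (auto intro!: mult_right_mono simp del: of_nat_Suc)
    ultimately have "\<bar>real n * g t - real n * t * g 1\<bar> \<le> g 1"
      by (simp add: algebra_simps abs_le_iff)
    moreover have "\<bar>real n * g t - real n * t * g 1\<bar> = real n * \<bar>g t - t * g 1\<bar>"
      by (metis abs_mult abs_of_nat mult.assoc right_diff_distrib)
    ultimately show ?thesis by simp
  qed
  then have "\<bar>g t - t * g 1\<bar> = 0"
    by (intro real_archimedian_rdiv_eq_0[where c = "g 1"]) (use mono[of 0 1] g0 in auto)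
  then show ?thesis by simp
qed

text \<open>
  The lower bound at \<open>r = R\<close> forces \<open>levy_tail \<nu> R \<noteq> 0\<close>, because the quotient would otherwise be
  zero.  This is what rules out a trivial subordinator.
\<close>
lemma poly_cond_tail_lower_bound:
  assumes "poly_cond \<nu> R1"
  obtains R c \<beta> where "0 < R" "0 < levy_tail \<nu> R" "0 < c" "0 < \<beta>"
    "\<And>r. 0 < r \<Longrightarrow> r \<le> R \<Longrightarrow> c * (R / r) powr \<beta> * levy_tail \<nu> R \<le> levy_tail \<nu> r"
proof -
  from assms obtain c \<beta> where R1: "0 < R1" and c: "0 < c" and \<beta>: "0 < \<beta>" and
    lb: "\<And>r R. 0 < r \<Longrightarrow> r \<le> R \<Longrightarrow> ereal R < R1 \<Longrightarrow> c * (R / r) powr \<beta> \<le> levy_tail \<nu> r / levy_tail \<nu> R"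
    unfolding poly_cond_def by blast
  obtain R where R: "0 < R" "ereal R < R1"
    using R1 ereal_dense2[of 0 R1] by auto
  have "levy_tail \<nu> R \<noteq> 0"
    using lb[of R R] R c by auto
  then have "0 < levy_tail \<nu> R" by (simp add: levy_tail_def zero_less_measure_iff)
  moreover from this have "c * (R / r) powr \<beta> * levy_tail \<nu> R \<le> levy_tail \<nu> r" if "0 < r" "r \<le> R" for r
    using lb[OF that R(2)] by (simp add: pos_le_divide_eq)
  ultimately show thesis using R c \<beta> that by blast
qed

context driftless_subordinator
begin

lemma AE_nonneg:
  assumes "0 \<le> t"
  shows "AE \<omega> in M. 0 \<le> S t \<omega>"
  using start_S mono_S
proof eventually_elim
  case (elim \<omega>)
  with assms monotone_onD[OF elim(2), of 0 t] show ?case by simp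
qed

text \<open>
  \<open>S\<^sub>s\<^sub>+\<^sub>t\<close> is the sum of the increments over \<open>[0,s]\<close> and \<open>[s,s+t]\<close>, which are independent and
  distributed like \<open>S\<^sub>s\<close> and \<open>S\<^sub>t\<close>.
\<close>
lemma nn_integral_exp_add:
  assumes "0 \<le> s" "0 \<le> t"
  shows "(\<integral>\<^sup>+\<omega>. ennreal (exp (- u * S (s + t) \<omega>)) \<partial>M) =
    (\<integral>\<^sup>+\<omega>. ennreal (exp (- u * S s \<omega>)) \<partial>M) * (\<integral>\<^sup>+\<omega>. ennreal (exp (- u * S t \<omega>)) \<partial>M)"
proof -
  have [measurable]: "S s \<in> borel_measurable M" "S t \<in> borel_measurable M"
    "S (s + t) \<in> borel_measurable M" "S 0 \<in> borel_measurable M"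
    using rv_S assms by auto
  define \<tau> :: "nat \<Rightarrow> real" where "\<tau> i = (if i = 0 then 0 else if i = 1 then s else s + t)" for i
  define X where "X i \<omega> = ennreal (exp (- u * (S (\<tau> (Suc i)) \<omega> - S (\<tau> i) \<omega>)))" for i \<omega>
  have "mono \<tau>" "\<And>i. 0 \<le> \<tau> i"
    using assms by (auto simp: \<tau>_def intro!: monoI)
  then have "indep_vars (\<lambda>_. borel) (\<lambda>i \<omega>. S (\<tau> (Suc i)) \<omega> - S (\<tau> i) \<omega>) {..<2 :: nat}"
    by (intro independent_increments)
  then have "indep_vars (\<lambda>_. borel) X {..<2 :: nat}"
    unfolding X_def by (rule indep_vars_compose2) measurable
  then have "(\<integral>\<^sup>+\<omega>. (\<Prod>i<2. X i \<omega>) \<partial>M) = (\<Prod>i<2. \<integral>\<^sup>+\<omega>. X i \<omega> \<partial>M)"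
    by (intro indep_vars_nn_integral) auto
  moreover have "(\<integral>\<^sup>+\<omega>. ennreal (exp (- u * S (s + t) \<omega>)) \<partial>M) = (\<integral>\<^sup>+\<omega>. (\<Prod>i<2. X i \<omega>) \<partial>M)"
  proof (rule nn_integral_cong_AE)
    show "AE \<omega> in M. ennreal (exp (- u * S (s + t) \<omega>)) = (\<Prod>i<2. X i \<omega>)"
      using start_S
    proof eventually_elim
      case (elim \<omega>)
      then show ?case
        by (simp add: X_def \<tau>_def numeral_2_eq_2 flip: ennreal_mult exp_add)
           (simp add: algebra_simps)
    qed
  qed
  moreover have increment: "(\<integral>\<^sup>+\<omega>. ennreal (exp (- u * (S (a + b) \<omega> - S a \<omega>))) \<partial>M) =
      (\<integral>\<^sup>+\<omega>. ennreal (exp (- u * S b \<omega>)) \<partial>M)" if "0 \<le> a" "0 \<le> b" for a b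
  proof -
    have [measurable]: "S a \<in> borel_measurable M" "S b \<in> borel_measurable M"
      "S (a + b) \<in> borel_measurable M" using rv_S that by auto
    have "(\<integral>\<^sup>+x. ennreal (exp (- u * x)) \<partial>distr M borel (\<lambda>\<omega>. S (a + b) \<omega> - S a \<omega>)) =
        (\<integral>\<^sup>+x. ennreal (exp (- u * x)) \<partial>distr M borel (S b))"
      using stationary_increments[OF that] by simp
    then show ?thesis by (simp add: nn_integral_distr)
  qed
  have "(\<integral>\<^sup>+\<omega>. X 0 \<omega> \<partial>M) = (\<integral>\<^sup>+\<omega>. ennreal (exp (- u * S s \<omega>)) \<partial>M)"
    using increment[of 0 s] assms by (simp add: X_def \<tau>_def)
  moreover have "(\<integral>\<^sup>+\<omega>. X 1 \<omega> \<partial>M) = (\<integral>\<^sup>+\<omega>. ennreal (exp (- u * S t \<omega>)) \<partial>M)"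
    using increment[of s t] assms by (simp add: X_def \<tau>_def numeral_2_eq_2)
  ultimately show ?thesis
    by (simp add: numeral_2_eq_2)
qed

text \<open>
  The exponent is given at time one only.  The negative logarithm of the Laplace transform is
  additive in time and, as the paths increase, monotone; hence it is linear.
\<close>
lemma laplace_transform:
  assumes t: "0 \<le> t" and u: "0 \<le> u"
  shows "(\<integral>\<^sup>+s. ennreal (exp (- u * s)) \<partial>distr M borel (S t)) = ennreal (exp (- t * levy_exponent \<nu> u))"
proof -
  define f where "f r = expectation (\<lambda>\<omega>. exp (- u * S r \<omega>))" for r
  have integrable: "integrable M (\<lambda>\<omega>. exp (- u * S r \<omega>))" if "0 \<le> r" for r
  proof (rule integrable_const_bound[where B = 1])
    show "AE \<omega> in M. norm (exp (- u * S r \<omega>)) \<le> 1"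
      using AE_nonneg[OF that] by eventually_elim (use u in simp)
  qed (use rv_S[OF that] in measurable)
  have f: "(\<integral>\<^sup>+\<omega>. ennreal (exp (- u * S r \<omega>)) \<partial>M) = ennreal (f r)" if "0 \<le> r" for r
    unfolding f_def using integrable[OF that] by (intro nn_integral_eq_integral) auto
  have f_pos: "0 < f r" if "0 \<le> r" for r
  proof -
    have "0 \<le> f r" unfolding f_def by (intro integral_nonneg_AE) simp
    moreover have "f r \<noteq> 0"
    proof
      assume "f r = 0"
      then have "AE \<omega> in M. exp (- u * S r \<omega>) = 0"
        unfolding f_def using integral_nonneg_eq_0_iff_AE[OF integrable[OF that]] by simp
      then have "AE \<omega> in M. False" by simp
      then show False by simp
    qed
    ultimately show ?thesis by simp
  qed
  have mult: "f (r + s) = f r * f s" if "0 \<le> r" "0 \<le> s" for r s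
  proof -
    have "ennreal (f (r + s)) = ennreal (f r * f s)"
      using nn_integral_exp_add[OF that, of u] f[of r] f[of s] f[of "r + s"] that
        f_pos[of r] f_pos[of s]
      by (simp add: ennreal_mult)
    then show ?thesis using f_pos[of r] f_pos[of s] f_pos[of "r + s"] that by simp
  qed
  have antimono: "f s \<le> f r" if "0 \<le> r" "r \<le> s" for r s
    unfolding f_def
  proof (rule integral_mono_AE)
    show "AE \<omega> in M. exp (- u * S s \<omega>) \<le> exp (- u * S r \<omega>)"
      using mono_S
    proof eventually_elim
      case (elim \<omega>)
      with that monotone_onD[OF elim, of r s] have "S r \<omega> \<le> S s \<omega>" by simp
      with u show ?case by (simp add: mult_left_mono)
    qed
  qed (use integrable that in auto)
  have "- ln (f t) = t * (- ln (f 1))"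
  proof (rule additive_mono_on_nonneg_imp_linear[of "\<lambda>r. - ln (f r)"])
    show "- ln (f (r + s)) = - ln (f r) + - ln (f s)" if "0 \<le> r" "0 \<le> s" for r s
      using mult[OF that] f_pos[of r] f_pos[of s] that by (simp add: ln_mult)
    show "- ln (f r) \<le> - ln (f s)" if "0 \<le> r" "r \<le> s" for r s
      using antimono[OF that] f_pos[of s] that by simp
  qed (fact t)
  also have "- ln (f 1) = levy_exponent \<nu> u"
    using laplace_exponent[OF u] by (simp add: f_def)
  finally have "f t = exp (- t * levy_exponent \<nu> u)"
    using f_pos[OF t] by (metis exp_ln minus_equation_iff minus_mult_left)
  moreover have "(\<integral>\<^sup>+s. ennreal (exp (- u * s)) \<partial>distr M borel (S t)) =
      (\<integral>\<^sup>+\<omega>. ennreal (exp (- u * S t \<omega>)) \<partial>M)"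
    using rv_S[OF t] by (intro nn_integral_distr) auto
  ultimately show ?thesis using f[OF t] by simp
qed

lemma AE_levy_measure_pos: "AE s in \<nu>. 0 < s"
  using nu_nonpos sets_nu by (intro AE_I[of _ _ "{..0}"]) auto

lemma integrable_levy_exponent:
  assumes "0 \<le> u"
  shows "integrable \<nu> (\<lambda>s. 1 - exp (- u * s))"
proof (rule Bochner_Integration.integrable_bound)
  note [measurable_cong] = sets_nu
  show "integrable \<nu> (\<lambda>s. max 1 u * min 1 s)"
  proof (rule integrable_mult_right, rule integrableI_nonneg)
    show "AE s in \<nu>. 0 \<le> min 1 s" using AE_levy_measure_pos by eventually_elim simp
  qed (use nu_levy in auto)
  show "(\<lambda>s. 1 - exp (- u * s)) \<in> borel_measurable \<nu>" by measurable
  show "AE s in \<nu>. norm (1 - exp (- u * s)) \<le> norm (max 1 u * min 1 s)"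
    using AE_levy_measure_pos
  proof eventually_elim
    case (elim s)
    have "1 - exp (- u * s) \<le> u * s" using exp_ge_add_one_self[of "- u * s"] by simp
    also have "\<dots> \<le> max 1 u * s" using elim by (intro mult_right_mono) auto
    finally have "1 - exp (- u * s) \<le> max 1 u * min 1 s"
      by (cases "s \<le> 1") (auto simp: min_def max_def intro: order.trans[of _ 1])
    moreover have "0 \<le> 1 - exp (- u * s)" using assms elim by simp
    ultimately show ?case by simp
  qed
qed

lemma levy_exponent_mono:
  assumes "0 \<le> u" "u \<le> v"
  shows "levy_exponent \<nu> u \<le> levy_exponent \<nu> v"
  unfolding levy_exponent_def
proof (rule integral_mono_AE)
  show "AE s in \<nu>. 1 - exp (- u * s) \<le> 1 - exp (- v * s)"
    using AE_levy_measure_pos by eventually_elim (use assms in \<open>simp add: mult_right_mono\<close>)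
qed (use assms integrable_levy_exponent in auto)

lemma levy_exponent_strict_mono:
  assumes "0 \<le> u" "u < v" and tail: "0 < levy_tail \<nu> r" "0 \<le> r"
  shows "levy_exponent \<nu> u < levy_exponent \<nu> v"
proof -
  let ?d = "\<lambda>s. (1 - exp (- v * s)) - (1 - exp (- u * s))"
  have int: "integrable \<nu> ?d"
    using assms by (intro Bochner_Integration.integrable_diff integrable_levy_exponent) auto
  have "integral\<^sup>L \<nu> ?d = levy_exponent \<nu> v - levy_exponent \<nu> u"
    unfolding levy_exponent_def
    using assms by (intro Bochner_Integration.integral_diff integrable_levy_exponent) auto
  moreover have nonneg: "AE s in \<nu>. 0 \<le> ?d s"
    using AE_levy_measure_pos by eventually_elim (use assms in \<open>simp add: mult_right_mono\<close>)
  have "integral\<^sup>L \<nu> ?d \<noteq> 0"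
  proof
    assume "integral\<^sup>L \<nu> ?d = 0"
    then have "AE s in \<nu>. ?d s = 0"
      using integral_nonneg_eq_0_iff_AE[OF int nonneg] by simp
    then have "AE s in \<nu>. s \<notin> {r<..}"
      by eventually_elim (use assms in auto)
    then have "emeasure \<nu> {r<..} = 0"
      using AE_iff_measurable[of "{r<..}" \<nu> "\<lambda>s. s \<notin> {r<..}"] sets_nu sets_eq_imp_space_eq[OF sets_nu]
      by (auto simp: not_le)
    then show False using tail by (simp add: levy_tail_def measure_def)
  qed
  moreover have "0 \<le> integral\<^sup>L \<nu> ?d" using nonneg by (rule integral_nonneg_AE)
  ultimately show ?thesis by linarith
qed

text \<open>
  Jumps larger than \<open>1 / u\<close> contribute at least \<open>1 - exp(- 1)\<close> each.  If the tail is infinite, its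
  real-valued measure is zero and the bound is trivial.
\<close>
lemma levy_exponent_ge_tail:
  assumes u: "0 < u"
  shows "(1 - exp (- 1)) * levy_tail \<nu> (1 / u) \<le> levy_exponent \<nu> u"
proof (cases "levy_tail \<nu> (1 / u) = 0")
  case True
  have "0 \<le> levy_exponent \<nu> u"
    using levy_exponent_mono[of 0 u] u by (simp add: levy_exponent_def)
  with True show ?thesis by simp
next
  case False
  note [measurable_cong] = sets_nu
  have "emeasure \<nu> {1 / u<..} < \<infinity>"
    using False by (metis infinity_ennreal_def less_top levy_tail_def measure_zero_top)
  then have int: "integrable \<nu> (\<lambda>s. (1 - exp (- 1)) * indicator {1 / u<..} s :: real)"
    by (intro integrable_mult_right integrable_real_indicator) (auto simp: sets_nu)
  have "(1 - exp (- 1)) * levy_tail \<nu> (1 / u) = (\<integral>s. (1 - exp (- 1)) * indicator {1 / u<..} s \<partial>\<nu>)"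
    using sets_nu sets_eq_imp_space_eq[OF sets_nu] by (simp add: levy_tail_def)
  also have "\<dots> \<le> levy_exponent \<nu> u"
    unfolding levy_exponent_def
  proof (rule integral_mono_AE[OF int integrable_levy_exponent])
    show "AE s in \<nu>. (1 - exp (- 1)) * indicator {1 / u<..} s \<le> 1 - exp (- u * s)"
      using AE_levy_measure_pos
    proof eventually_elim
      case (elim s)
      then show ?case using u by (auto simp: indicator_def field_simps)
    qed
  qed (use u in simp)
  finally show ?thesis .
qed

lemma levy_exponent_ge_powr:
  assumes "poly_cond \<nu> R1"
  shows "\<exists>c>0. \<exists>\<beta>>0. \<exists>u0>0. \<forall>u\<ge>u0. c * u powr \<beta> \<le> levy_exponent \<nu> u"
proof -
  obtain R c1 \<beta> where R: "0 < R" "0 < levy_tail \<nu> R" and c1: "0 < c1" and \<beta>: "0 < \<beta>" and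
    lb: "\<And>r. 0 < r \<Longrightarrow> r \<le> R \<Longrightarrow> c1 * (R / r) powr \<beta> * levy_tail \<nu> R \<le> levy_tail \<nu> r"
    using poly_cond_tail_lower_bound[OF assms] by blast
  define c where "c = (1 - exp (- 1)) * (c1 * R powr \<beta> * levy_tail \<nu> R)"
  have "c * u powr \<beta> \<le> levy_exponent \<nu> u" if u: "1 / R \<le> u" for u
  proof -
    have "0 < 1 / R" using R by simp
    then have u_pos: "0 < u" using u by linarith
    have "c1 * (R / (1 / u)) powr \<beta> * levy_tail \<nu> R \<le> levy_tail \<nu> (1 / u)"
      using u u_pos R by (intro lb) (auto simp: field_simps)
    then have "(1 - exp (- 1)) * (c1 * (R / (1 / u)) powr \<beta> * levy_tail \<nu> R) \<le>
        (1 - exp (- 1)) * levy_tail \<nu> (1 / u)"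
      by (intro mult_left_mono) auto
    also have "\<dots> \<le> levy_exponent \<nu> u" by (rule levy_exponent_ge_tail[OF u_pos])
    finally show ?thesis using R u_pos by (simp add: c_def powr_mult mult_ac)
  qed
  moreover have "0 < c" using R c1 by (simp add: c_def)
  ultimately show ?thesis using \<beta> R by (meson divide_pos_pos zero_less_one)
qed

end

section \<open>Exponential moments from the Laplace transform\<close>

lemma summable_powr_mult_exp_neg_powr:
  fixes K a b :: real
  assumes "a > 0" "b > 0"
  shows "summable (\<lambda>n. (real n + 1) powr K * exp (- a * real n powr b))"
proof (rule summable_comparison_test_bigo)
  show "summable (\<lambda>n. norm (real n powr - 2))"
    by (simp add: summable_real_powr_iff)
  show "(\<lambda>n. (real n + 1) powr K * exp (- a * real n powr b)) \<in> O(\<lambda>n. real n powr - 2)"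
    using assms by real_asymp
qed

lemma term_le_suminf: "f n \<le> (\<Sum>i. f i)" for f :: "nat \<Rightarrow> ennreal"
  using sum_le_suminf[OF summableI, of "{n}" f] by simp

text \<open>
  A single term dominates: for \<open>n = \<lfloor>1 / s\<rfloor>\<close> one has \<open>n s \<le> 1\<close>, so \<open>exp(1 - n s) \<ge> 1\<close>, and
  \<open>1 / s \<le> n + 1\<close>.  The series is a discrete form of the Gamma integral for \<open>s\<^sup>-\<^sup>K\<close>; its exponentials
  integrate to values of the Laplace transform.
\<close>
lemma powr_minus_le_suminf_exp:
  fixes s K :: real
  assumes s: "0 < s" and K: "0 \<le> K"
  shows "ennreal (s powr - K) \<le> (\<Sum>n. ennreal (exp 1 * (real n + 1) powr K * exp (- real n * s)))"
proof -
  define n where "n = nat \<lfloor>1 / s\<rfloor>"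
  have n: "real n \<le> 1 / s" "1 / s \<le> real n + 1"
    using of_nat_floor[of "1 / s"] floor_correct[of "1 / s"] s by (auto simp: n_def)
  have "s powr - K = (1 / s) powr K"
    using powr_minus_divide[of s K] powr_divide[of 1 s K] by simp
  also have "\<dots> \<le> (real n + 1) powr K" using n s K by (intro powr_mono2) auto
  also have "\<dots> \<le> exp 1 * (real n + 1) powr K * exp (- real n * s)"
  proof -
    have "1 \<le> exp 1 * exp (- real n * s)"
    proof -
      have "0 \<le> 1 - real n * s" using n(1) s by (simp add: pos_le_divide_eq)
      moreover have "exp 1 * exp (- real n * s) = exp (1 - real n * s)"
        using exp_add[of 1 "- real n * s"] by simp
      ultimately show ?thesis by simp
    qed
    then have "(real n + 1) powr K * 1 \<le> (real n + 1) powr K * (exp 1 * exp (- real n * s))"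
      by (intro mult_left_mono) auto
    then show ?thesis by (simp add: mult_ac)
  qed
  finally have "ennreal (s powr - K) \<le> ennreal (exp 1 * (real n + 1) powr K * exp (- real n * s))"
    by (rule ennreal_leI)
  also have "\<dots> \<le> (\<Sum>n. ennreal (exp 1 * (real n + 1) powr K * exp (- real n * s)))"
    by (rule term_le_suminf)
  finally show ?thesis .
qed

text \<open>
  Write \<open>\<lambda>\<close> for \<open>lam\<close>.  By \<open>powr_minus_le_suminf_exp\<close> the moment is at most a multiple of the sum of the terms \<open>(n + 1)\<^sup>K exp(- t \<phi>(n + \<lambda>))\<close>.
  Taking out \<open>exp(- t \<phi>(\<lambda>))\<close> leaves exponents \<open>-t (\<phi>(n + \<lambda>) - \<phi>(\<lambda>))\<close>, which monotonicity of \<open>\<phi>\<close>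
  lets one replace by their values at \<open>t = T\<close>; growth of \<open>\<phi>\<close> then gives a convergent series.
  The constant is chosen before \<open>t\<close> and \<open>\<mu>\<close>, so that it serves all starting points.
\<close>
lemma negative_moment_le_exp:
  fixes \<phi> :: "real \<Rightarrow> real"
  assumes mono: "\<And>u v. 0 \<le> u \<Longrightarrow> u \<le> v \<Longrightarrow> \<phi> u \<le> \<phi> v"
    and growth: "0 < c" "0 < \<beta>" "\<And>u. u0 \<le> u \<Longrightarrow> c * u powr \<beta> \<le> \<phi> u"
    and T: "0 < T" and lam: "0 \<le> lam" and K: "0 \<le> K"
  shows "\<exists>C>0. \<forall>t\<ge>T. \<forall>\<mu>. sets \<mu> = sets borel \<longrightarrow>
    (\<forall>u\<ge>0. (\<integral>\<^sup>+s. ennreal (exp (- u * s)) \<partial>\<mu>) = ennreal (exp (- t * \<phi> u))) \<longrightarrow>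
    (\<integral>\<^sup>+s\<in>{0<..}. ennreal (s powr - K * exp (- lam * s)) \<partial>\<mu>) \<le> ennreal (C * exp (- t * \<phi> lam))"
proof -
  define a where "a n = exp 1 * (real n + 1) powr K * exp (- T * (\<phi> (real n + lam) - \<phi> lam))" for n
  have a_nonneg: "0 \<le> a n" for n by (simp add: a_def)
  have "summable a"
  proof (rule summable_comparison_test_ev)
    show "summable (\<lambda>n. exp (1 + T * \<phi> lam) * ((real n + 1) powr K * exp (- (T * c) * real n powr \<beta>)))"
      using growth T by (intro summable_mult summable_powr_mult_exp_neg_powr) auto
    have "eventually (\<lambda>n. u0 \<le> real n) sequentially" by real_asymp
    then show "eventually (\<lambda>n. norm (a n) \<le>
        exp (1 + T * \<phi> lam) * ((real n + 1) powr K * exp (- (T * c) * real n powr \<beta>))) sequentially"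
    proof eventually_elim
      case (elim n)
      have "c * real n powr \<beta> \<le> \<phi> (real n + lam)"
        using growth(3)[OF elim] mono[of "real n" "real n + lam"] lam by simp
      then have "T * (c * real n powr \<beta>) \<le> T * \<phi> (real n + lam)"
        using T by (intro mult_left_mono) auto
      then have "exp (- T * (\<phi> (real n + lam) - \<phi> lam)) \<le> exp (T * \<phi> lam) * exp (- (T * c) * real n powr \<beta>)"
        by (simp add: algebra_simps flip: exp_add)
      then have "exp 1 * (real n + 1) powr K * exp (- T * (\<phi> (real n + lam) - \<phi> lam)) \<le>
          exp 1 * (real n + 1) powr K * (exp (T * \<phi> lam) * exp (- (T * c) * real n powr \<beta>))"
        by (intro mult_left_mono) auto
      then show ?case using a_nonneg[of n] by (simp add: a_def exp_add mult_ac)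
    qed
  qed
  define C where "C = suminf a + 1"
  have "0 < C" using suminf_nonneg[OF \<open>summable a\<close> a_nonneg] by (simp add: C_def)
  moreover have "(\<integral>\<^sup>+s\<in>{0<..}. ennreal (s powr - K * exp (- lam * s)) \<partial>\<mu>) \<le> ennreal (C * exp (- t * \<phi> lam))"
    if t: "T \<le> t" and sets[measurable_cong]: "sets \<mu> = sets borel"
      and laplace: "\<And>u. 0 \<le> u \<Longrightarrow> (\<integral>\<^sup>+s. ennreal (exp (- u * s)) \<partial>\<mu>) = ennreal (exp (- t * \<phi> u))" for t \<mu>
  proof -
    have "(\<integral>\<^sup>+s\<in>{0<..}. ennreal (s powr - K * exp (- lam * s)) \<partial>\<mu>) \<le>
        (\<integral>\<^sup>+s. (\<Sum>n. ennreal (exp 1 * (real n + 1) powr K) * ennreal (exp (- (real n + lam) * s))) \<partial>\<mu>)"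
    proof (rule nn_integral_mono)
      fix s :: real
      show "ennreal (s powr - K * exp (- lam * s)) * indicator {0<..} s \<le>
          (\<Sum>n. ennreal (exp 1 * (real n + 1) powr K) * ennreal (exp (- (real n + lam) * s)))"
      proof (cases "0 < s")
        case True
        have "ennreal (s powr - K * exp (- lam * s)) = ennreal (s powr - K) * ennreal (exp (- lam * s))"
          by (simp add: ennreal_mult)
        also have "\<dots> \<le> (\<Sum>n. ennreal (exp 1 * (real n + 1) powr K * exp (- real n * s))) * ennreal (exp (- lam * s))"
          by (intro mult_right_mono powr_minus_le_suminf_exp True K) simp
        also have "\<dots> = (\<Sum>n. ennreal (exp 1 * (real n + 1) powr K * exp (- real n * s)) * ennreal (exp (- lam * s)))"
          by simp
        also have "\<dots> = (\<Sum>n. ennreal (exp 1 * (real n + 1) powr K) * ennreal (exp (- (real n + lam) * s)))"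
        proof (intro suminf_cong)
          fix n
          have "exp (- real n * s) * exp (- lam * s) = exp (- (real n + lam) * s)"
            by (simp add: algebra_simps flip: exp_add)
          then have "exp 1 * (real n + 1) powr K * exp (- real n * s) * exp (- lam * s) =
              exp 1 * (real n + 1) powr K * exp (- (real n + lam) * s)"
            by (simp only: mult.assoc)
          then show "ennreal (exp 1 * (real n + 1) powr K * exp (- real n * s)) * ennreal (exp (- lam * s)) =
              ennreal (exp 1 * (real n + 1) powr K) * ennreal (exp (- (real n + lam) * s))"
            by (subst ennreal_mult'[symmetric], simp)+ (rule arg_cong)
        qed
        finally show ?thesis using True by simp
      qed simp
    qed
    also have "\<dots> = (\<Sum>n. ennreal (exp 1 * (real n + 1) powr K) * (\<integral>\<^sup>+s. ennreal (exp (- (real n + lam) * s)) \<partial>\<mu>))"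
      by (simp add: nn_integral_suminf nn_integral_cmult)
    also have "\<dots> = (\<Sum>n. ennreal (exp 1 * (real n + 1) powr K * exp (- t * \<phi> (real n + lam))))"
      using lam by (subst laplace) (simp_all add: ennreal_mult)
    also have "\<dots> \<le> (\<Sum>n. ennreal (a n * exp (- t * \<phi> lam)))"
    proof (intro suminf_le ennreal_leI)
      fix n
      have "T * (\<phi> (real n + lam) - \<phi> lam) \<le> t * (\<phi> (real n + lam) - \<phi> lam)"
        using t lam mono[of lam "real n + lam"] by (intro mult_right_mono) auto
      then have "exp (- t * \<phi> (real n + lam)) \<le> exp (- T * (\<phi> (real n + lam) - \<phi> lam)) * exp (- t * \<phi> lam)"
        by (simp add: algebra_simps flip: exp_add)
      then have "exp 1 * (real n + 1) powr K * exp (- t * \<phi> (real n + lam)) \<le>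
          exp 1 * (real n + 1) powr K * (exp (- T * (\<phi> (real n + lam) - \<phi> lam)) * exp (- t * \<phi> lam))"
        by (intro mult_left_mono) auto
      then show "exp 1 * (real n + 1) powr K * exp (- t * \<phi> (real n + lam)) \<le> a n * exp (- t * \<phi> lam)"
        by (simp add: a_def mult_ac)
    qed auto
    also have "\<dots> = ennreal (suminf a * exp (- t * \<phi> lam))"
      using \<open>summable a\<close> a_nonneg
      by (subst suminf_ennreal2) (auto simp: suminf_mult2 intro: summable_mult2)
    also have "\<dots> \<le> ennreal (C * exp (- t * \<phi> lam))"
      by (intro ennreal_leI mult_right_mono) (auto simp: C_def)
    finally show ?thesis .
  qed
  ultimately show ?thesis by blast
qed

text \<open>
  Write \<open>\<lambda>\<close> for \<open>lam\<close>.  Below \<open>\<delta>\<close> one has \<open>exp(- \<lambda> s) \<le> exp(\<delta>) exp(- (\<lambda> + 1) s)\<close>, whose integral is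
  \<open>exp(\<delta>) exp(- t \<phi>(\<lambda> + 1))\<close>; by the choice of \<open>\<delta>\<close> this is at most the fraction \<open>exp(- \<delta>)\<close> of the full integral.
\<close>
lemma exp_moment_away_from_zero_ge:
  fixes \<phi> :: "real \<Rightarrow> real"
  assumes sets: "sets \<mu> = sets borel"
    and laplace: "\<And>u. 0 \<le> u \<Longrightarrow> (\<integral>\<^sup>+s. ennreal (exp (- u * s)) \<partial>\<mu>) = ennreal (exp (- t * \<phi> u))"
    and lam: "0 \<le> lam" and \<delta>: "2 * \<delta> \<le> t * (\<phi> (lam + 1) - \<phi> lam)"
  shows "ennreal ((1 - exp (- \<delta>)) * exp (- t * \<phi> lam)) \<le> (\<integral>\<^sup>+s\<in>{\<delta>..}. ennreal (exp (- lam * s)) \<partial>\<mu>)"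
proof -
  note [measurable_cong] = sets
  let ?I = "\<integral>\<^sup>+s\<in>{\<delta>..}. ennreal (exp (- lam * s)) \<partial>\<mu>"
  have "ennreal (exp (- t * \<phi> lam)) = (\<integral>\<^sup>+s. ennreal (exp (- lam * s)) \<partial>\<mu>)"
    by (rule laplace[OF lam, symmetric])
  also have "\<dots> \<le> (\<integral>\<^sup>+s. ennreal (exp (- lam * s)) * indicator {\<delta>..} s +
      ennreal (exp \<delta>) * ennreal (exp (- (lam + 1) * s)) \<partial>\<mu>)"
  proof (rule nn_integral_mono)
    fix s :: real
    show "ennreal (exp (- lam * s)) \<le> ennreal (exp (- lam * s)) * indicator {\<delta>..} s +
      ennreal (exp \<delta>) * ennreal (exp (- (lam + 1) * s))"
    proof (cases "\<delta> \<le> s")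
      case False
      then have "exp (- lam * s) \<le> exp \<delta> * exp (- (lam + 1) * s)"
        by (simp add: algebra_simps flip: exp_add)
      with False show ?thesis by (simp flip: ennreal_mult)
    qed simp
  qed
  also have "\<dots> = ?I + ennreal (exp \<delta>) * (\<integral>\<^sup>+s. ennreal (exp (- (lam + 1) * s)) \<partial>\<mu>)"
    by (simp add: nn_integral_add nn_integral_cmult)
  also have "\<dots> = ?I + ennreal (exp (\<delta> - t * \<phi> (lam + 1)))"
    using lam by (simp add: laplace[of "lam + 1", simplified] exp_diff exp_minus divide_inverse flip: ennreal_mult)
  also have "\<dots> \<le> ?I + ennreal (exp (- \<delta>) * exp (- t * \<phi> lam))"
    using \<delta> by (intro add_left_mono ennreal_leI) (simp add: algebra_simps flip: exp_add)
  finally have "ennreal (exp (- t * \<phi> lam)) - ennreal (exp (- \<delta>) * exp (- t * \<phi> lam)) \<le> ?I"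
    by (simp add: ennreal_minus_le_iff add.commute)
  then show ?thesis by (simp add: ennreal_minus algebra_simps)
qed

section \<open>Heat kernel bounds at times at most one\<close>

context volume_space
begin

lemma sets_m: "sets m = sets borel"
  using radon by (simp add: radon_measure_def)

lemma emeasure_finite_of_bounded:
  assumes "bounded B"
  shows "emeasure m B \<noteq> \<infinity>"
proof -
  have "compact (closure B)"
    using assms by (intro bounded_closed_compact) (auto simp: bounded_closure)
  then have "emeasure m (closure B) < \<infinity>" using radon unfolding radon_measure_def by blast
  moreover have "emeasure m B \<le> emeasure m (closure B)"
    by (intro emeasure_mono closure_subset) (auto simp: sets_m)
  ultimately show ?thesis by auto
qed

lemma measure_mono_of_bounded:
  assumes "A \<subseteq> B" "bounded B" "B \<in> sets borel"
  shows "measure m A \<le> measure m B"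
  unfolding measure_def
  using assms emeasure_finite_of_bounded[of B]
  by (intro enn2real_mono emeasure_mono) (auto simp: sets_m less_top)

lemma measure_pos_of_open:
  assumes "open U" "U \<noteq> {}" "bounded U"
  shows "0 < measure m U"
  using assms support emeasure_finite_of_bounded[of U]
  by (auto simp: full_support_def measure_def enn2real_positive_iff less_top)

lemma vol_pos: "0 < r \<Longrightarrow> 0 < vol m x r"
  unfolding vol_def by (intro measure_pos_of_open) auto

lemma vol_mono: "r \<le> s \<Longrightarrow> vol m x r \<le> vol m x s"
  unfolding vol_def by (intro measure_mono_of_bounded) (auto simp: subset_ball)

lemma vol_le_uniform:
  assumes "bounded D"
  shows "\<exists>C>0. \<forall>x\<in>D. vol m x r \<le> C"
proof (cases "D = {}")
  case False
  then obtain x0 where x0: "x0 \<in> D" by auto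
  have "vol m x r \<le> vol m x0 (diameter D + \<bar>r\<bar> + 1)" if "x \<in> D" for x
    unfolding vol_def
  proof (rule measure_mono_of_bounded)
    have "dist x x0 \<le> diameter D" using assms that x0 by (rule diameter_bounded_bound)
    show "ball x r \<subseteq> ball x0 (diameter D + \<bar>r\<bar> + 1)"
    proof
      fix z assume "z \<in> ball x r"
      then have "dist x0 z < diameter D + r"
        using dist_triangle[of x0 z x] \<open>dist x x0 \<le> diameter D\<close> by (simp add: dist_commute)
      then show "z \<in> ball x0 (diameter D + \<bar>r\<bar> + 1)" by simp
    qed
  qed auto
  moreover have "0 < vol m x0 (diameter D + \<bar>r\<bar> + 1)"
    using diameter_ge_0[OF assms] by (intro vol_pos) auto
  ultimately show ?thesis by blast
qed (auto intro: exI[of _ 1])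

text \<open>
  At the fixed radius \<open>diameter D + 1\<close> every ball with centre in \<open>D\<close> contains \<open>D\<close>, so its volume has
  a lower bound independent of the centre; volume scaling carries it down to small radii.
\<close>
lemma vol_ge_powr:
  assumes D: "bounded D" "open D"
  shows "\<exists>c>0. \<exists>d>0. \<forall>x\<in>D. \<forall>r. 0 < r \<and> r \<le> 1 \<longrightarrow> c * r powr d \<le> vol m x r"
proof (cases "D = {}")
  case False
  define R where "R = diameter D + 1"
  have R: "1 \<le> R" using diameter_ge_0[OF D(1)] by (simp add: R_def)
  obtain RE :: ereal and d1 d2 where RE: "0 < RE" and d: "0 < d1" "d1 \<le> d2" and
    scal: "\<And>a. 1 \<le> a \<Longrightarrow> \<exists>CV\<ge>1. \<forall>x r R. 0 < r \<and> r \<le> R \<and> ereal R < ereal a * RE \<longrightarrow>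
        (R / r) powr d1 / CV \<le> vol m x R / vol m x r \<and> vol m x R / vol m x r \<le> CV * (R / r) powr d2"
    using scaling unfolding volume_scaling_def by blast
  obtain e where e: "0 < e" "ereal e < RE" using RE ereal_dense2[of 0 RE] by auto
  define a where "a = max 1 (R / e)"
  have "ereal R \<le> ereal a * ereal e"
    using e by (simp add: a_def max_def field_simps)
  also have "\<dots> < ereal a * RE"
    using e by (intro ereal_mult_strict_left_mono) (auto simp: a_def max_def)
  finally have aR: "ereal R < ereal a * RE" .
  obtain CV where CV: "1 \<le> CV" and
    ub: "\<And>x r. 0 < r \<Longrightarrow> r \<le> R \<Longrightarrow> vol m x R / vol m x r \<le> CV * (R / r) powr d2"
    using scal[of a] aR by (auto simp: a_def)
  have mD: "0 < measure m D" using D False by (intro measure_pos_of_open) auto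
  define c where "c = measure m D / (CV * R powr d2)"
  have "c * r powr d2 \<le> vol m x r" if x: "x \<in> D" and r: "0 < r" "r \<le> 1" for x r
  proof -
    have "D \<subseteq> ball x R"
      using diameter_bounded_bound[OF D(1) x] by (force simp: R_def)
    then have "measure m D \<le> vol m x R"
      unfolding vol_def by (intro measure_mono_of_bounded) auto
    also have "\<dots> \<le> CV * (R / r) powr d2 * vol m x r"
      using ub[of r x] r R vol_pos[OF r(1), of x] by (simp add: field_simps)
    finally have "measure m D * r powr d2 \<le> CV * R powr d2 * vol m x r"
      using r R by (simp add: powr_divide field_simps)
    then show ?thesis using CV R by (simp add: c_def field_simps)
  qed
  moreover have "0 < c" using mD CV R by (simp add: c_def)
  ultimately show ?thesis using d by (intro exI[of _ c] conjI exI[of _ d2]) auto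
qed (auto intro: exI[of _ 1])

text \<open>
  The alternative is that \<open>D\<close> is an isolated point.  Small balls around it would then all have the
  same volume, contrary to the lower bound in volume scaling.  Positivity of the diameter puts time
  one into the range in which the growth of a boundary function in time is controlled.
\<close>
lemma diameter_pos_of_open:
  fixes D :: "'a set"
  assumes D: "bounded D" "open D" "D \<noteq> {}"
  shows "0 < diameter D"
proof (rule ccontr)
  assume "\<not> 0 < diameter D"
  obtain x where x: "x \<in> D" using D by auto
  have "dist x y = 0" if "y \<in> D" for y
    using diameter_bounded_bound[OF D(1) x that] \<open>\<not> 0 < diameter D\<close> zero_le_dist[of x y] by linarith
  then have "y = x" if "y \<in> D" for y
    using that by fastforce
  then have "D = {x}" using x by blast
  then obtain e where e: "0 < e" "ball x e \<subseteq> {x}"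
    using D(2) by (auto simp: open_contains_ball)
  have vol_eq: "vol m x r = measure m {x}" if "0 < r" "r \<le> e" for r
    unfolding vol_def using e that subset_ball[of r e x] by (intro arg_cong[where f = "measure m"]) auto
  obtain RE :: ereal and d1 CV where RE: "0 < RE" and d1: "0 < d1" and CV: "1 \<le> CV" and
    lb: "\<And>r R. 0 < r \<Longrightarrow> r \<le> R \<Longrightarrow> ereal R < RE \<Longrightarrow> (R / r) powr d1 / CV \<le> vol m x R / vol m x r"
  proof -
    obtain RE :: ereal and d1 d2 where "0 < RE" "0 < d1" and
      "\<And>a. 1 \<le> a \<Longrightarrow> \<exists>CV\<ge>1. \<forall>x r R. 0 < r \<and> r \<le> R \<and> ereal R < ereal a * RE \<longrightarrow>
        (R / r) powr d1 / CV \<le> vol m x R / vol m x r \<and> vol m x R / vol m x r \<le> CV * (R / r) powr d2"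
      using scaling unfolding volume_scaling_def by blast
    note RE = this
    from RE(3)[of 1] obtain CV where "1 \<le> CV" and
      "\<And>x r R. 0 < r \<Longrightarrow> r \<le> R \<Longrightarrow> ereal R < ereal 1 * RE \<Longrightarrow> (R / r) powr d1 / CV \<le> vol m x R / vol m x r"
      by auto
    with RE(1,2) show thesis by (intro that[of RE d1 CV]) (simp_all flip: one_ereal_def)
  qed
  obtain R' where R': "0 < R'" "ereal R' < RE" using RE ereal_dense2[of 0 RE] by auto
  define R where "R = min R' e"
  have R: "0 < R" "R \<le> e" "ereal R < RE"
    using e R' by (auto simp: R_def min_def intro: le_less_trans[of _ "ereal R'"])
  \<comment> \<open>Shrinking a ball by the factor \<open>b\<close> would at least halve its volume.\<close>
  define b where "b = (2 * CV) powr (1 / d1)"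
  have b: "1 \<le> b" unfolding b_def using CV d1 by (intro ge_one_powr_ge_zero) auto
  have "b powr d1 = 2 * CV" using CV d1 by (simp add: b_def powr_powr)
  moreover have "(R / (R / b)) powr d1 / CV \<le> vol m x R / vol m x (R / b)"
    using R b by (intro lb) (auto simp: field_simps)
  moreover have "R / b \<le> R / 1" using R b by (intro divide_left_mono) auto
  then have "vol m x (R / b) = vol m x R"
    using vol_eq[of R] vol_eq[of "R / b"] R b by simp
  ultimately show False using R b CV vol_pos[of R x] by simp
qed

end

lemma scale_function_pos:
  fixes f :: "real \<Rightarrow> real"
  assumes "strict_mono_on {0..} f" "\<And>r. 0 \<le> r \<Longrightarrow> 0 \<le> f r" "0 < r"
  shows "0 < f r"
  using strict_mono_onD[OF assms(1), of 0 r] assms(2)[of 0] assms(3) by simp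

lemma scale_inverse_set_nonempty:
  assumes f: "strict_mono_on {0..} f" "\<And>r. 0 \<le> r \<Longrightarrow> 0 \<le> f r" "power_scaling f"
  shows "{r. 0 \<le> r \<and> t \<le> f r} \<noteq> {}"
proof -
  obtain c \<alpha> where c: "0 < c" "0 < \<alpha>" and
    lb: "\<And>r R. 0 < r \<Longrightarrow> r \<le> R \<Longrightarrow> c * (R / r) powr \<alpha> \<le> f R / f r"
    using f(3) unfolding power_scaling_def by blast
  have f1: "0 < f 1" using scale_function_pos[OF f(1,2)] by simp
  define R where "R = max 1 ((\<bar>t\<bar> / (c * f 1)) powr (1 / \<alpha>))"
  have "\<bar>t\<bar> / (c * f 1) = ((\<bar>t\<bar> / (c * f 1)) powr (1 / \<alpha>)) powr \<alpha>"
    using c f1 by (simp add: powr_powr)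
  also have "\<dots> \<le> R powr \<alpha>" using c by (intro powr_mono2) (auto simp: R_def)
  finally have "\<bar>t\<bar> \<le> c * R powr \<alpha> * f 1" using c f1 by (simp add: field_simps)
  also have "\<dots> \<le> f R" using lb[of 1 R] f1 by (simp add: R_def field_simps)
  finally have "R \<in> {r. 0 \<le> r \<and> t \<le> f r}" by (auto simp: R_def)
  then show ?thesis by blast
qed

lemma scale_inverse_mono:
  assumes "strict_mono_on {0..} f" "\<And>r. 0 \<le> r \<Longrightarrow> 0 \<le> f r" "power_scaling f" "s \<le> t"
  shows "scale_inverse f s \<le> scale_inverse f t"
  unfolding scale_inverse_def
proof (rule cInf_superset_mono)
  show "{r. 0 \<le> r \<and> t \<le> f r} \<noteq> {}" by (rule scale_inverse_set_nonempty[OF assms(1-3)])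
qed (use assms(4) in \<open>auto intro: bdd_belowI[of _ 0]\<close>)

text \<open>
  The lower scaling bound on \<open>f\<close> reads \<open>f(r) \<le> A r\<^sup>\<alpha>\<close> for \<open>r \<le> 1\<close>, and inverting it gives the exponent
  \<open>1 / \<alpha>\<close>.
\<close>
lemma scale_inverse_ge_powr:
  assumes f: "strict_mono_on {0..} f" "\<And>r. 0 \<le> r \<Longrightarrow> 0 \<le> f r" "power_scaling f"
  shows "\<exists>c>0. \<exists>e>0. \<forall>t. 0 < t \<and> t \<le> 1 \<longrightarrow> c * t powr e \<le> scale_inverse f t"
proof -
  obtain c \<alpha> where c: "0 < c" "0 < \<alpha>" and
    lb: "\<And>r R. 0 < r \<Longrightarrow> r \<le> R \<Longrightarrow> c * (R / r) powr \<alpha> \<le> f R / f r"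
    using f(3) unfolding power_scaling_def by blast
  have f_pos: "0 < f r" if "0 < r" for r using scale_function_pos[OF f(1,2) that] .
  define A where "A = f 1 / c"
  have A: "0 < A" using f_pos[of 1] c by (simp add: A_def)
  define b where "b = min 1 (A powr (- 1 / \<alpha>))"
  have b: "0 < b" "b \<le> 1" using A by (auto simp: b_def)
  have pos: "b * t powr (1 / \<alpha>) \<le> r" if t: "0 < t" "t \<le> 1" "t \<le> f r" and r: "0 < r" for t r
  proof (cases "r \<le> 1")
    case True
    have "c * (1 / r) powr \<alpha> \<le> f 1 / f r" using True r by (intro lb) auto
    then have "f r \<le> A * r powr \<alpha>"
      using c r f_pos[OF r] by (simp add: A_def powr_divide field_simps)
    then have "t / A \<le> r powr \<alpha>" using t A by (simp add: field_simps)
    then have "(t / A) powr (1 / \<alpha>) \<le> (r powr \<alpha>) powr (1 / \<alpha>)"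
      using t A c by (intro powr_mono2) auto
    then have "A powr (- 1 / \<alpha>) * t powr (1 / \<alpha>) \<le> r"
      using t A c r by (simp add: powr_powr powr_divide powr_minus_divide)
    moreover have "b * t powr (1 / \<alpha>) \<le> A powr (- 1 / \<alpha>) * t powr (1 / \<alpha>)"
      by (intro mult_right_mono) (auto simp: b_def)
    ultimately show ?thesis by linarith
  next
    case False
    have "t powr (1 / \<alpha>) \<le> 1" using t c by (intro powr_le1) auto
    then have "b * t powr (1 / \<alpha>) \<le> 1" using b by (intro mult_le_one) auto
    with False show ?thesis by simp
  qed
  have "b * t powr (1 / \<alpha>) \<le> scale_inverse f t" if t: "0 < t" "t \<le> 1" for t
    unfolding scale_inverse_def
  proof (rule cInf_greatest)
    show "{r. 0 \<le> r \<and> t \<le> f r} \<noteq> {}" by (rule scale_inverse_set_nonempty[OF f])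
    fix r assume r: "r \<in> {r. 0 \<le> r \<and> t \<le> f r}"
    \<comment> \<open>If \<open>t \<le> f 0\<close>, every \<open>r' > 0\<close> satisfies \<open>t \<le> f r'\<close>, which contradicts the bound just shown.\<close>
    show "b * t powr (1 / \<alpha>) \<le> r"
    proof (cases "r = 0")
      case True
      define r' where "r' = b * t powr (1 / \<alpha>) / 2"
      have "0 < r'" using b t by (simp add: r'_def)
      moreover from this have "t \<le> f r'"
        using r strict_mono_onD[OF f(1), of 0 r'] True by auto
      ultimately have "b * t powr (1 / \<alpha>) \<le> r'" using t by (intro pos) auto
      with \<open>0 < r'\<close> show ?thesis by (simp add: r'_def)
    qed (use r pos t in auto)
  qed
  then show ?thesis using b c by (intro exI[of _ b] conjI exI[of _ "1 / \<alpha>"]) auto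
qed

lemma one_divide_ennreal: "0 < v \<Longrightarrow> 1 / ennreal v = ennreal (1 / v)"
  using divide_ennreal[of 1 v] by simp

lemma heat_bound_le: "heat_bound m \<Phi> \<Psi> C0 c t x y \<le> 1 / ennreal (vol m x (scale_inverse \<Phi> t))"
  by (simp add: heat_bound_def)

lemma heat_bound_ge:
  assumes "0 \<le> c"
  shows "1 / ennreal (vol m x (scale_inverse \<Phi> t)) *
      ennreal (exp (- (c * (dist x y)\<^sup>2 / (scale_inverse \<Phi> t)\<^sup>2))) \<le> heat_bound m \<Phi> \<Psi> C0 c t x y"
proof -
  have "1 / ennreal (vol m x (scale_inverse \<Phi> t)) *
      ennreal (exp (- (c * (dist x y)\<^sup>2 / (scale_inverse \<Phi> t)\<^sup>2))) \<le>
      1 / ennreal (vol m x (scale_inverse \<Phi> t)) * 1"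
    using assms by (intro mult_left_mono) (auto simp: ennreal_le_1)
  then show ?thesis by (auto simp: heat_bound_def intro: add_increasing)
qed

text \<open>
  The volume \<open>V(x, \<Phi>\<^sup>-\<^sup>1(s))\<close> is at least a power of \<open>s\<close>, and \<open>h(s,x,y)\<close> exceeds \<open>h(1,x,y)\<close> by at most the
  factor \<open>c s\<^sup>-\<^sup>\<gamma>\<close>.
\<close>
lemma (in volume_space) heat_kernel_le_powr:
  assumes D: "bounded D" "open D" and scale: "scale_functions \<Phi> \<Psi>"
    and boundary: "boundary_function \<Phi> D h" and c: "0 < c"
    and p: "\<And>t x y. 0 < t \<Longrightarrow> t \<le> 1 \<Longrightarrow> x \<in> D \<Longrightarrow> y \<in> D \<Longrightarrow>
      ennreal (p t x y) \<le> ennreal (c * h t x y) * heat_bound m \<Phi> \<Psi> C0 c' t x y"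
  shows "\<exists>C>0. \<exists>K\<ge>0. \<forall>s. \<forall>x\<in>D. \<forall>y\<in>D. 0 < s \<and> s \<le> 1 \<longrightarrow> p s x y \<le> C * s powr - K * h 1 x y"
proof (cases "D = {}")
  case False
  have \<Phi>: "strict_mono_on {0..} \<Phi>" "\<And>r. 0 \<le> r \<Longrightarrow> 0 \<le> \<Phi> r" "power_scaling \<Phi>"
    using scale by (auto simp: scale_functions_def)
  obtain cv d where v: "0 < cv" "0 < d" and vol: "\<And>x r. x \<in> D \<Longrightarrow> 0 < r \<Longrightarrow> r \<le> 1 \<Longrightarrow> cv * r powr d \<le> vol m x r"
    using vol_ge_powr[OF D] by blast
  obtain ci e where i: "0 < ci" "0 < e" and inv: "\<And>t. 0 < t \<Longrightarrow> t \<le> 1 \<Longrightarrow> ci * t powr e \<le> scale_inverse \<Phi> t"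
    using scale_inverse_ge_powr[OF \<Phi>] by blast
  have "0 < \<Phi> (diameter D)"
    using diameter_pos_of_open[OF D False] scale_function_pos[OF \<Phi>(1,2)] by blast
  then obtain ch \<gamma> where h: "0 < ch" "0 \<le> \<gamma>" and
    H2: "\<And>s x y. 0 < s \<Longrightarrow> s \<le> 1 \<Longrightarrow> x \<in> D \<Longrightarrow> y \<in> D \<Longrightarrow> s powr \<gamma> * h s x y \<le> ch * h 1 x y"
  proof -
    obtain ch \<gamma> where h: "0 < ch" "0 \<le> \<gamma>" and
      H2: "\<And>s t x y. x \<in> D \<Longrightarrow> y \<in> D \<Longrightarrow> 0 < s \<Longrightarrow> s \<le> t \<Longrightarrow> t < 4 * \<Phi> (diameter D) + 1 \<Longrightarrow>
        s powr \<gamma> * h s x y \<le> ch * t powr \<gamma> * h t x y"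
      using boundary unfolding boundary_function_def by blast
    show thesis
      using H2[of _ _ _ 1] \<open>0 < \<Phi> (diameter D)\<close> by (intro that[OF h]) auto
  qed
  have h_nonneg: "0 \<le> h s x y" if "0 < s" "x \<in> D" "y \<in> D" for s x y
    using boundary that by (auto simp: boundary_function_def)
  \<comment> \<open>Capping at 1 keeps the radius \<open>ci' * s powr e\<close> in the range of the volume bound.\<close>
  define ci' where "ci' = min 1 ci"
  have ci': "0 < ci'" "ci' \<le> 1" "ci' \<le> ci" using i by (auto simp: ci'_def)
  define b where "b = cv * ci' powr d"
  have b: "0 < b" using v ci' by (simp add: b_def)
  have "p s x y \<le> c * ch / b * s powr - (\<gamma> + e * d) * h 1 x y"
    if s: "0 < s" "s \<le> 1" and x: "x \<in> D" and y: "y \<in> D" for s x y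
  proof -
    have "s powr e \<le> 1" using s i by (intro powr_le1) auto
    then have r: "0 < ci' * s powr e" "ci' * s powr e \<le> 1"
      using ci' s by (auto intro!: mult_le_one)
    have "b * s powr (e * d) = cv * (ci' * s powr e) powr d"
      using ci' by (simp add: b_def powr_mult powr_powr)
    also have "\<dots> \<le> vol m x (ci' * s powr e)" by (rule vol[OF x r])
    also have "\<dots> \<le> vol m x (scale_inverse \<Phi> s)"
      using mult_right_mono[OF ci'(3), of "s powr e"] inv[OF s] by (intro vol_mono) auto
    finally have V: "b * s powr (e * d) \<le> vol m x (scale_inverse \<Phi> s)" .
    have bs: "0 < b * s powr (e * d)" using b s by simp
    have h_le: "h s x y \<le> ch * s powr - \<gamma> * h 1 x y"
      using H2[OF s x y] s by (simp add: powr_minus field_simps)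
    have "ennreal (p s x y) \<le> ennreal (c * h s x y) * (1 / ennreal (vol m x (scale_inverse \<Phi> s)))"
      using p[OF s x y] mult_left_mono[OF heat_bound_le] by (rule order.trans) auto
    also have "\<dots> = ennreal (c * h s x y * (1 / vol m x (scale_inverse \<Phi> s)))"
    proof -
      have "0 < vol m x (scale_inverse \<Phi> s)" using V bs by linarith
      then show ?thesis
        using c h_nonneg[OF s(1) x y] by (subst one_divide_ennreal, simp) (intro ennreal_mult'[symmetric], simp)
    qed
    finally have "p s x y \<le> c * h s x y * (1 / vol m x (scale_inverse \<Phi> s))"
      using V bs c h_nonneg[OF s(1) x y] by (subst (asm) ennreal_le_iff) (auto intro!: mult_nonneg_nonneg)
    also have "\<dots> \<le> c * (ch * s powr - \<gamma> * h 1 x y) * (1 / (b * s powr (e * d)))"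
      using V bs c h_le h_nonneg[OF s(1) x y] by (intro mult_mono mult_left_mono divide_left_mono) auto
    also have "\<dots> = c * ch / b * s powr - (\<gamma> + e * d) * h 1 x y"
    proof -
      have "s powr - (\<gamma> + e * d) = s powr - \<gamma> * (1 / s powr (e * d))"
        using powr_add[of s "- \<gamma>" "- (e * d)"] powr_minus_divide[of s "e * d"] by simp
      then show ?thesis by (simp add: mult_ac)
    qed
    finally show ?thesis .
  qed
  moreover have "0 < c * ch / b" "0 \<le> \<gamma> + e * d" using c h b i v by auto
  ultimately show ?thesis by blast
qed (auto intro: exI[of _ 1])

text \<open>
  For \<open>s\<close> bounded away from zero the Gaussian factor is at least its value at distance
  \<open>diameter D\<close> and time \<open>\<delta>\<close>, the volume is at most that of a fixed large ball, and
  \<open>h(s,x,y) \<ge> h(1,x,y)\<close> by monotonicity.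
\<close>
lemma (in volume_space) heat_kernel_ge_const:
  assumes D: "bounded D" and scale: "scale_functions \<Phi> \<Psi>"
    and boundary: "boundary_function \<Phi> D h" and c: "0 < c" "0 < c'"
    and p: "\<And>t x y. 0 < t \<Longrightarrow> t \<le> 1 \<Longrightarrow> x \<in> D \<Longrightarrow> y \<in> D \<Longrightarrow>
      ennreal (c * h t x y) * heat_bound m \<Phi> \<Psi> C0 c' t x y \<le> ennreal (p t x y)"
    and \<delta>: "0 < \<delta>" "\<delta> \<le> 1"
  shows "\<exists>C>0. \<forall>s. \<forall>x\<in>D. \<forall>y\<in>D. \<delta> \<le> s \<and> s \<le> 1 \<longrightarrow> ennreal (C * h 1 x y) \<le> ennreal (p s x y)"
proof -
  have \<Phi>: "strict_mono_on {0..} \<Phi>" "\<And>r. 0 \<le> r \<Longrightarrow> 0 \<le> \<Phi> r" "power_scaling \<Phi>"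
    using scale by (auto simp: scale_functions_def)
  obtain V where V: "0 < V" and vol: "\<And>x. x \<in> D \<Longrightarrow> vol m x (scale_inverse \<Phi> 1) \<le> V"
    using vol_le_uniform[OF D] by blast
  obtain ci e where i: "0 < ci" "0 < e" and inv: "\<And>t. 0 < t \<Longrightarrow> t \<le> 1 \<Longrightarrow> ci * t powr e \<le> scale_inverse \<Phi> t"
    using scale_inverse_ge_powr[OF \<Phi>] by blast
  define \<rho> where "\<rho> = scale_inverse \<Phi> \<delta>"
  have "0 < ci * \<delta> powr e" using i \<delta> by simp
  then have \<rho>: "0 < \<rho>" using inv[OF \<delta>] by (simp add: \<rho>_def)
  define E where "E = exp (- (c' * (diameter D)\<^sup>2 / \<rho>\<^sup>2))"
  have "ennreal (c / V * E * h 1 x y) \<le> ennreal (p s x y)"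
    if s: "\<delta> \<le> s" "s \<le> 1" and x: "x \<in> D" and y: "y \<in> D" for s x y
  proof -
    have s0: "0 < s" using s \<delta> by simp
    have h: "0 \<le> h 1 x y" "h 1 x y \<le> h s x y"
      using boundary x y s s0 by (auto simp: boundary_function_def monotone_on_def)
    let ?r = "scale_inverse \<Phi> s"
    have r: "\<rho> \<le> ?r" "?r \<le> scale_inverse \<Phi> 1"
      unfolding \<rho>_def using s by (auto intro!: scale_inverse_mono[OF \<Phi>])
    have vr: "0 < vol m x ?r" using r \<rho> by (intro vol_pos) simp
    have vV: "vol m x ?r \<le> V" using vol_mono[OF r(2)] vol[OF x] by (rule order.trans)
    have "(dist x y)\<^sup>2 / ?r\<^sup>2 \<le> (diameter D)\<^sup>2 / \<rho>\<^sup>2"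
      using diameter_bounded_bound[OF D x y] r \<rho> by (intro frac_le power_mono) auto
    then have "c' * ((dist x y)\<^sup>2 / ?r\<^sup>2) \<le> c' * ((diameter D)\<^sup>2 / \<rho>\<^sup>2)"
      using c by (intro mult_left_mono) auto
    then have E: "E \<le> exp (- (c' * (dist x y)\<^sup>2 / ?r\<^sup>2))" by (simp add: E_def)
    have "c / V * E * h 1 x y = c * h 1 x y * (1 / V * E)" by simp
    also have "\<dots> \<le> c * h s x y * (1 / vol m x ?r * exp (- (c' * (dist x y)\<^sup>2 / ?r\<^sup>2)))"
      using h c V vr vV E by (intro mult_mono frac_le) (auto simp: E_def)
    finally have "ennreal (c / V * E * h 1 x y) \<le>
        ennreal (c * h s x y * (1 / vol m x ?r * exp (- (c' * (dist x y)\<^sup>2 / ?r\<^sup>2))))"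
      by (rule ennreal_leI)
    also have "\<dots> = ennreal (c * h s x y) *
        (1 / ennreal (vol m x ?r) * ennreal (exp (- (c' * (dist x y)\<^sup>2 / ?r\<^sup>2))))"
    proof -
      have "0 \<le> c * h s x y" using h c by simp
      then show ?thesis
        using vr by (simp only: one_divide_ennreal ennreal_mult' exp_ge_zero divide_nonneg_nonneg zero_le_one less_imp_le)
    qed
    also have "\<dots> \<le> ennreal (c * h s x y) * heat_bound m \<Phi> \<Psi> C0 c' s x y"
      using c by (intro mult_left_mono heat_bound_ge) auto
    also have "\<dots> \<le> ennreal (p s x y)" using s0 s(2) x y by (rule p)
    finally show ?thesis .
  qed
  moreover have "0 < c / V * E" using c V by (simp add: E_def)
  ultimately show ?thesis by blast
qed

section \<open>Large-time estimate of the subordinate kernel\<close>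

theorem theorem4p7:
  fixes m :: "'a::metric_space measure" and D :: "'a set"
    and M :: "'w measure" and P :: "'a option \<Rightarrow> 'w measure"
    and Y :: "real \<Rightarrow> 'w \<Rightarrow> 'a option" and S :: "real \<Rightarrow> 'w \<Rightarrow> real"
    and \<nu> :: "real measure" and R1 :: ereal
    and \<Phi> \<Psi> :: "real \<Rightarrow> real"
    and h p :: "real \<Rightarrow> 'a \<Rightarrow> 'a \<Rightarrow> real" and lamD T :: real
  assumes space: "volume_space m"
    and open_D: "open D" and proper_D: "D \<noteq> UNIV"
    and hunt: "hunt_process D M P Y"
    and density: "heat_kernel m D M P Y p"
    and subordinator: "\<And>x. x \<in> topspace (cemetery_top D) \<Longrightarrow> driftless_subordinator (P x) S \<nu>"
    and independent: "independent_processes D P Y S"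
    and scale: "scale_functions \<Phi> \<Psi>"
    and poly: "poly_cond \<nu> R1"
    and normalized: "ereal (\<Phi> (diameter D)) < R1 / 8"
    and boundary: "boundary_function \<Phi> D h"
    and HK: "HK_B m D \<Phi> \<Psi> h p lamD"
    and T: "T > 0"
  shows "\<exists>c1>0. \<exists>c2>0. \<forall>t\<ge>T. \<forall>x\<in>D. \<forall>y\<in>D.
    ennreal (c1 * (exp (- t * levy_exponent \<nu> lamD) * h 1 x y)) \<le> subordinate_kernel P S p t x y \<and>
    subordinate_kernel P S p t x y \<le> ennreal (c2 * (exp (- t * levy_exponent \<nu> lamD) * h 1 x y))"
proof (cases "D = {}")
  case True
  then show ?thesis by (auto intro: exI[of _ 1])
next
  case False
  interpret volume_space m by (fact space)
  define \<phi> where "\<phi> = levy_exponent \<nu>"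
  have law: "driftless_subordinator (P (Some x)) S \<nu>" if "x \<in> D" for x
    using that by (intro subordinator) simp
  obtain x0 where x0: "x0 \<in> D" using False by auto
  interpret S0: driftless_subordinator "P (Some x0)" S \<nu> by (rule law[OF x0])
  have bounded: "bounded D" and lam: "0 < lamD"
    using HK by (simp_all add: HK_B_def)
  obtain C0 a1 a2 a3 a4 where a: "0 < a1" "0 < a2" "0 < a3" "0 < a4"
    and small: "\<forall>t\<in>{0<..1}. \<forall>x\<in>D. \<forall>y\<in>D.
      ennreal (a1 * h t x y) * heat_bound m \<Phi> \<Psi> C0 a2 t x y \<le> ennreal (p t x y) \<and>
      ennreal (p t x y) \<le> ennreal (a3 * h t x y) * heat_bound m \<Phi> \<Psi> C0 a4 t x y"
    using HK unfolding HK_B_def by (elim conjE bexE exE) metis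
  obtain b1 b2 where b: "0 < b1" "0 < b2"
    and large: "\<forall>t\<ge>1. \<forall>x\<in>D. \<forall>y\<in>D. b1 * (exp (- lamD * t) * h 1 x y) \<le> p t x y \<and>
      p t x y \<le> b2 * (exp (- lamD * t) * h 1 x y)"
    using HK unfolding HK_B_def by (elim conjE bexE exE) metis
  have h1: "0 \<le> h 1 x y" if "x \<in> D" "y \<in> D" for x y
    using boundary that by (simp add: boundary_function_def)
  have sets: "sets (distr (P (Some x)) borel (S t)) = sets borel" for x t by simp
  have laplace: "(\<integral>\<^sup>+s. ennreal (exp (- u * s)) \<partial>distr (P (Some x)) borel (S t)) = ennreal (exp (- t * \<phi> u))"
    if "x \<in> D" "T \<le> t" "0 \<le> u" for x t u
    unfolding \<phi>_def using driftless_subordinator.laplace_transform[OF law] that T by simp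

  obtain A K where A: "0 < A" and K: "0 \<le> K"
    and small_le: "\<And>s x y. x \<in> D \<Longrightarrow> y \<in> D \<Longrightarrow> 0 < s \<Longrightarrow> s \<le> 1 \<Longrightarrow> p s x y \<le> A * s powr - K * h 1 x y"
    using heat_kernel_le_powr[OF bounded open_D scale boundary a(3), of p C0 a4] small by auto
  obtain c \<beta> u0 where growth: "0 < c" "0 < \<beta>" "\<And>u. u0 \<le> u \<Longrightarrow> c * u powr \<beta> \<le> \<phi> u"
    using S0.levy_exponent_ge_powr[OF poly] unfolding \<phi>_def by blast
  obtain B where B: "0 < B" and moment: "\<And>t \<mu>. T \<le> t \<Longrightarrow> sets \<mu> = sets borel \<Longrightarrow>
      (\<And>u. 0 \<le> u \<Longrightarrow> (\<integral>\<^sup>+s. ennreal (exp (- u * s)) \<partial>\<mu>) = ennreal (exp (- t * \<phi> u))) \<Longrightarrow>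
      (\<integral>\<^sup>+s\<in>{0<..}. ennreal (s powr - K * exp (- lamD * s)) \<partial>\<mu>) \<le> ennreal (B * exp (- t * \<phi> lamD))"
  proof -
    have mono: "\<phi> u \<le> \<phi> v" if "0 \<le> u" "u \<le> v" for u v
      unfolding \<phi>_def using that by (rule S0.levy_exponent_mono)
    have "\<exists>B>0. \<forall>t\<ge>T. \<forall>\<mu>. sets \<mu> = sets borel \<longrightarrow>
        (\<forall>u\<ge>0. (\<integral>\<^sup>+s. ennreal (exp (- u * s)) \<partial>\<mu>) = ennreal (exp (- t * \<phi> u))) \<longrightarrow>
        (\<integral>\<^sup>+s\<in>{0<..}. ennreal (s powr - K * exp (- lamD * s)) \<partial>\<mu>) \<le> ennreal (B * exp (- t * \<phi> lamD))"
      by (rule negative_moment_le_exp[OF mono growth T less_imp_le[OF lam] K])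
    then obtain B where "0 < B" and B: "\<forall>t\<ge>T. \<forall>\<mu>. sets \<mu> = sets borel \<longrightarrow>
        (\<forall>u\<ge>0. (\<integral>\<^sup>+s. ennreal (exp (- u * s)) \<partial>\<mu>) = ennreal (exp (- t * \<phi> u))) \<longrightarrow>
        (\<integral>\<^sup>+s\<in>{0<..}. ennreal (s powr - K * exp (- lamD * s)) \<partial>\<mu>) \<le> ennreal (B * exp (- t * \<phi> lamD))"
      by (elim exE conjE)
    from \<open>0 < B\<close> show thesis by (rule that) (rule B[rule_format])
  qed
  have upper: "subordinate_kernel P S p t x y \<le> ennreal ((A * exp lamD * B + b2) * (exp (- t * \<phi> lamD) * h 1 x y))"
    if t: "T \<le> t" and x: "x \<in> D" and y: "y \<in> D" for t x y
  proof -
    let ?\<mu> = "distr (P (Some x)) borel (S t)"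
    have "subordinate_kernel P S p t x y \<le> (\<integral>\<^sup>+s. ennreal (A * exp lamD * h 1 x y) *
        (ennreal (s powr - K * exp (- lamD * s)) * indicator {0<..} s) +
        ennreal (b2 * h 1 x y) * ennreal (exp (- lamD * s)) \<partial>?\<mu>)"
      unfolding subordinate_kernel_def
    proof (rule nn_integral_mono)
      fix s
      show "ennreal (p s x y) * indicator {0<..} s \<le> ennreal (A * exp lamD * h 1 x y) *
          (ennreal (s powr - K * exp (- lamD * s)) * indicator {0<..} s) +
          ennreal (b2 * h 1 x y) * ennreal (exp (- lamD * s))"
      proof (cases "0 < s")
        case True
        \<comment> \<open>The constant \<open>exp lamD\<close> pays for the factor \<open>exp (- lamD * s)\<close>, which the bound on \<open>(0,1]\<close> lacks.\<close>
        have "p s x y \<le> A * exp lamD * h 1 x y * (s powr - K * exp (- lamD * s)) +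
            b2 * h 1 x y * exp (- lamD * s)"
        proof (cases "s \<le> 1")
          case s1: True
          have "1 \<le> exp (lamD * (1 - s))" using s1 lam by simp
          also have "\<dots> = exp lamD * exp (- lamD * s)"
            by (simp add: right_diff_distrib flip: exp_add)
          finally have "A * s powr - K * h 1 x y * 1 \<le>
              A * s powr - K * h 1 x y * (exp lamD * exp (- lamD * s))"
            using A h1[OF x y] by (intro mult_left_mono) auto
          moreover have "0 \<le> b2 * h 1 x y * exp (- lamD * s)" using b h1[OF x y] by simp
          ultimately show ?thesis using small_le[OF x y True s1] by (simp add: mult_ac)
        next
          case False
          have "0 \<le> A * exp lamD * h 1 x y * (s powr - K * exp (- lamD * s))"
            using A h1[OF x y] by simp
          moreover have "p s x y \<le> b2 * h 1 x y * exp (- lamD * s)"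
            using large[rule_format, of s x y] x y False by (simp add: mult_ac)
          ultimately show ?thesis by linarith
        qed
        then show ?thesis
        proof -
          let ?u = "A * exp lamD * h 1 x y" and ?v = "b2 * h 1 x y"
          have "ennreal (p s x y) \<le>
              ennreal (?u * (s powr - K * exp (- lamD * s)) + ?v * exp (- lamD * s))"
            by (rule ennreal_leI) fact
          also have "\<dots> = ennreal ?u * ennreal (s powr - K * exp (- lamD * s)) +
              ennreal ?v * ennreal (exp (- lamD * s))"
          proof -
            have "0 \<le> ?u" "0 \<le> ?v" "0 \<le> s powr - K * exp (- lamD * s)"
              using A b h1[OF x y] by auto
            then show ?thesis
              by (simp only: ennreal_plus ennreal_mult mult_nonneg_nonneg exp_ge_zero)
          qed
          finally show ?thesis using True by simp
        qed
      qed simp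
    qed
    also have "\<dots> = ennreal (A * exp lamD * h 1 x y) *
        (\<integral>\<^sup>+s\<in>{0<..}. ennreal (s powr - K * exp (- lamD * s)) \<partial>?\<mu>) +
        ennreal (b2 * h 1 x y) * (\<integral>\<^sup>+s. ennreal (exp (- lamD * s)) \<partial>?\<mu>)"
      by (subst nn_integral_add, measurable, subst (1 2) nn_integral_cmult, measurable)
    also have "\<dots> \<le> ennreal (A * exp lamD * h 1 x y) * ennreal (B * exp (- t * \<phi> lamD)) +
        ennreal (b2 * h 1 x y) * ennreal (exp (- t * \<phi> lamD))"
      using moment[OF t sets laplace[OF x t]] laplace[OF x t, of lamD] lam
      by (intro add_mono mult_left_mono) auto
    also have "\<dots> = ennreal ((A * exp lamD * B + b2) * (exp (- t * \<phi> lamD) * h 1 x y))"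
    proof -
      have "0 \<le> A * exp lamD * h 1 x y" "0 \<le> b2 * h 1 x y" "0 \<le> B * exp (- t * \<phi> lamD)"
        using A B b h1[OF x y] by auto
      then have "ennreal (A * exp lamD * h 1 x y) * ennreal (B * exp (- t * \<phi> lamD)) +
          ennreal (b2 * h 1 x y) * ennreal (exp (- t * \<phi> lamD)) =
          ennreal (A * exp lamD * h 1 x y * (B * exp (- t * \<phi> lamD)) + b2 * h 1 x y * exp (- t * \<phi> lamD))"
        by (simp only: ennreal_plus ennreal_mult mult_nonneg_nonneg exp_ge_zero)
      then show ?thesis by (simp add: algebra_simps)
    qed
    finally show ?thesis .
  qed

  define d where "d = \<phi> (lamD + 1) - \<phi> lamD"
  obtain R where "0 < R" "0 < levy_tail \<nu> R"
    using poly_cond_tail_lower_bound[OF poly] by blast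
  then have d: "0 < d"
    using S0.levy_exponent_strict_mono[of lamD "lamD + 1" R] lam by (simp add: d_def \<phi>_def)
  \<comment> \<open>The first bound on \<open>\<delta>\<close> makes the tilting argument work for all \<open>t \<ge> T\<close>.\<close>
  define \<delta> where "\<delta> = min (T * d / 2) 1"
  have \<delta>: "0 < \<delta>" "\<delta> \<le> 1" using T d by (auto simp: \<delta>_def)
  obtain k where k: "0 < k" and small_ge: "\<And>s x y. x \<in> D \<Longrightarrow> y \<in> D \<Longrightarrow> \<delta> \<le> s \<Longrightarrow> s \<le> 1 \<Longrightarrow>
      ennreal (k * h 1 x y) \<le> ennreal (p s x y)"
    using heat_kernel_ge_const[OF bounded scale boundary a(1,2) _ \<delta>, of C0 p] small by auto
  define L where "L = min k b1"
  have L: "0 < L" "L \<le> k" "L \<le> b1" using k b by (auto simp: L_def)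
  have lower: "ennreal (L * (1 - exp (- \<delta>)) * (exp (- t * \<phi> lamD) * h 1 x y)) \<le> subordinate_kernel P S p t x y"
    if t: "T \<le> t" and x: "x \<in> D" and y: "y \<in> D" for t x y
  proof -
    let ?\<mu> = "distr (P (Some x)) borel (S t)"
    have "2 * \<delta> \<le> T * d" by (simp add: \<delta>_def)
    also have "\<dots> \<le> t * d" using t d by (intro mult_right_mono) auto
    finally have "2 * \<delta> \<le> t * (\<phi> (lamD + 1) - \<phi> lamD)" by (simp add: d_def)
    then have tail: "ennreal ((1 - exp (- \<delta>)) * exp (- t * \<phi> lamD)) \<le>
        (\<integral>\<^sup>+s\<in>{\<delta>..}. ennreal (exp (- lamD * s)) \<partial>?\<mu>)"
      using lam by (intro exp_moment_away_from_zero_ge[OF sets laplace[OF x t]]) auto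
    have "ennreal (L * (1 - exp (- \<delta>)) * (exp (- t * \<phi> lamD) * h 1 x y)) =
        ennreal (L * h 1 x y) * ennreal ((1 - exp (- \<delta>)) * exp (- t * \<phi> lamD))"
      using L h1[OF x y] \<delta> by (subst ennreal_mult[symmetric]) (auto simp: mult_ac)
    also have "\<dots> \<le> ennreal (L * h 1 x y) * (\<integral>\<^sup>+s\<in>{\<delta>..}. ennreal (exp (- lamD * s)) \<partial>?\<mu>)"
      by (intro mult_left_mono tail) simp
    also have "\<dots> = (\<integral>\<^sup>+s. ennreal (L * h 1 x y) * (ennreal (exp (- lamD * s)) * indicator {\<delta>..} s) \<partial>?\<mu>)"
      by (rule nn_integral_cmult[symmetric]) measurable
    also have "\<dots> \<le> subordinate_kernel P S p t x y"
      unfolding subordinate_kernel_def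
    proof (rule nn_integral_mono)
      fix s
      show "ennreal (L * h 1 x y) * (ennreal (exp (- lamD * s)) * indicator {\<delta>..} s) \<le>
          ennreal (p s x y) * indicator {0<..} s"
      proof (cases "\<delta> \<le> s")
        case True
        have "ennreal (L * h 1 x y * exp (- lamD * s)) \<le> ennreal (p s x y)"
        proof (cases "s \<le> 1")
          case s1: True
          have "exp (- lamD * s) \<le> 1" using True \<delta> lam by simp
          then have "L * h 1 x y * exp (- lamD * s) \<le> k * h 1 x y * 1"
            using L k h1[OF x y] by (intro mult_mono) auto
          then have "ennreal (L * h 1 x y * exp (- lamD * s)) \<le> ennreal (k * h 1 x y)"
            by (simp add: ennreal_leI)
          also have "\<dots> \<le> ennreal (p s x y)" by (rule small_ge[OF x y True s1])
          finally show ?thesis .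
        next
          case False
          have "L * (exp (- lamD * s) * h 1 x y) \<le> b1 * (exp (- lamD * s) * h 1 x y)"
            using L h1[OF x y] by (intro mult_right_mono) auto
          also have "\<dots> \<le> p s x y" using large x y False by simp
          finally show ?thesis by (intro ennreal_leI) (simp add: mult_ac)
        qed
        moreover have "0 \<le> L * h 1 x y" using L h1[OF x y] by simp
        ultimately show ?thesis using True \<delta> by (simp add: ennreal_mult)
      qed simp
    qed
    finally show ?thesis .
  qed

  have "0 < L * (1 - exp (- \<delta>))" "0 < A * exp lamD * B + b2"
    using L \<delta> A B b by (auto intro: add_pos_pos)
  with lower upper show ?thesis unfolding \<phi>_def by blast
qed

end
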